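(* Let $\mathcal O$ be an octonion division algebra with center $k$, $\operatorname{char}(k)=2$, and let $\Psi$ be a polarity of type IV of the octonion plane $\mathbb P^2(\mathcal O)$, with corresponding automorphism $\eta$ of $\mathcal O$. Then the Moufang set associated to $\Psi$ is isomorphic to a Moufang subset of the projective Moufang set $\mathbb M(\mathcal O)$, namely $\mathbb M(V,\tau)$ with $V=\{y\in\mathcal O\mid\eta(\overline{y})=y\}$ (under addition) and $\tau(y)=y^{-1}$ for $y\in V\setminus\{0\}$; the root groups are $5$-dimensional subspaces of the $8$-dimensional vector space $\mathcal O$ over $k$.
   Context: $x\mapsto\overline{x}$ and $T(x)=x+\overline{x}$ denote the standard involution and trace of $\mathcal O$. Polarities of type IV: let $D$ be a $4$-dimensional subalgebra of $\mathcal O$ that is totally singular for the bilinear form of the norm (such $D$ exists in characteristic $2$ and is a subfield). Choose $z\in\mathcal O\setminus D$ with $T(z)=1$, so $\mathcal O=D\oplus Dz$ and $\overline{z}=z+1$. Then $\eta:\mathcal O\to\mathcal O$, $d+d'z\mapsto d+d'\overline{z}$ ($d,d'\in D$) is an automorphism of order two of $\mathcal O$. The plane $\mathbb P^2(\mathcal O)$ has points $(a,b)$, $(c)$, $(\infty)$ and lines $[m,k]$, $[l]$, $[\infty]$ (entries in $\mathcal O$), with incidence $(a,b)*[m,k]\iff ma+b=k$; $(a,b)*[l]\iff a=l$; $(c)*[m,k]\iff c=m$; $(c)*[\infty]$; $(\infty)*[l]$; $(\infty)*[\infty]$. The polarity of type IV induced by $\eta$ is $\Psi:(a,b)\leftrightarrow[\eta(\overline{a}),-\eta(\overline{b})]$,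 $(c)\leftrightarrow[\eta(\overline{c})]$, $(\infty)\leftrightarrow[\infty]$. A Moufang set $\bigl(X,(U_x)_{x\in X}\bigr)$ is a set $X$ together with groups $U_x\le\operatorname{Sym}(X)$ such that for each $x\in X$: (1) $U_x$ fixes $x$ and acts sharply transitively on $X\setminus\{x\}$; (2) $U_x^\varphi=U_{x\varphi}$ for all $\varphi\in\langle U_z\mid z\in X\rangle$. Isomorphisms are bijections of underlying sets carrying root groups to root groups. Construction $\mathbb M(U,\tau)$: for a group $(U,+)$ with identity $0$, let $X=U\cup\{\infty\}$, let $\alpha_a$ ($a\in U$) fix $\infty$ and map $x\mapsto x+a$, and $U_\infty=\{\alpha_a\mid a\in U\}$. Extend a permutation $\tau$ of $U\setminus\{0\}$ to $X$ by interchanging $0$ and $\infty$; put $U_0=U_\infty^\tau$, $U_a=U_0^{\alpha_a}$; then $\mathbb M(U,\tau)=\bigl(X,(U_x)_{x\in X}\bigr)$. The projective Moufang set $\mathbb M(\mathcal O)$ is $\mathbb M((\mathcal O,+),\tau)$ with $\tau(x)=-x^{-1}$. A Moufang subset is obtained from an additive subgroup $V\le\mathcal O$ such that $\tau$ preserves $V\setminus\{0\}$. The Moufang set associated to $\Psi$ has as underlying set the set of absolute points of $\Psi$ (points $p$ with $p*\Psi(p)$), assumed to have at least three elements; the root group of an absolute point $x$ is the group induced by the elements commuting with $\Psi$ in the product of the three root groups of the plane fixing the flag $(x,\Psi(x))$ in an apartment through that flag. Explicitly it is $\mathbb M(U,\tau)$ with $U=\{(a,b)\in\mathcal O\times\mathcal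 O\mid\eta(\overline{a})a+\eta(\overline{b})+b=0\}$, $(a,b)+(c,d)=(a+c,b+d-\eta(\overline{c})a)$, $\tau(a,b)=(-ab^{-1},b^{-1})$. *)

theory Defs
  imports Complex_Main "HOL-Algebra.Bij" "HOL-Algebra.Generated_Groups"
begin

section \<open>Octonion division algebras\<close>

text \<open>The underlying additive group is the whole type; the remaining structure
  is collected in a record, as the multiplication is not associative.\<close>

record ('k, 'a) normed_alg =
  scl :: "'k \<Rightarrow> 'a \<Rightarrow> 'a"
  mul :: "'a \<Rightarrow> 'a \<Rightarrow> 'a"
  unt :: 'a
  nrm :: "'a \<Rightarrow> 'k"

definition polar :: "('k::field, 'a::ab_group_add) normed_alg \<Rightarrow> 'a \<Rightarrow> 'a \<Rightarrow> 'k" where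
  "polar A x y = nrm A (x + y) - nrm A x - nrm A y"

text \<open>A composition algebra of dimension 8 whose norm is anisotropic. Nondegeneracy is
  required of the bilinear form, also in characteristic 2. The center of
  such an algebra is automatically the line spanned by the unit, i.e. the base field.\<close>

definition octonion_division_algebra :: "('k::field, 'a::ab_group_add) normed_alg \<Rightarrow> bool" where
  "octonion_division_algebra A \<longleftrightarrow>
     vector_space (scl A) \<and> vector_space.dim (scl A) (UNIV :: 'a set) = 8 \<and>
     (\<forall>y. Vector_Spaces.linear (scl A) (scl A) (\<lambda>x. mul A x y)) \<and>
     (\<forall>x. Vector_Spaces.linear (scl A) (scl A) (\<lambda>y. mul A x y)) \<and>
     (\<forall>x. mul A (unt A) x = x \<and> mul A x (unt A) = x) \<and>
     (\<forall>c x. nrm A (scl A c x) = c\<^sup>2 * nrm A x) \<and>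
     (\<forall>y. Vector_Spaces.linear (scl A) (*) (\<lambda>x. polar A x y)) \<and>
     (\<forall>x. (\<forall>y. polar A x y = 0) \<longrightarrow> x = 0) \<and>
     (\<forall>x y. nrm A (mul A x y) = nrm A x * nrm A y) \<and>
     (\<forall>x. nrm A x = 0 \<longrightarrow> x = 0)"

definition oct_conj :: "('k::field, 'a::ab_group_add) normed_alg \<Rightarrow> 'a \<Rightarrow> 'a" where
  "oct_conj A x = scl A (polar A x (unt A)) (unt A) - x"

definition oct_trace :: "('k::field, 'a::ab_group_add) normed_alg \<Rightarrow> 'a \<Rightarrow> 'a" where
  "oct_trace A x = x + oct_conj A x"

text \<open>Since \<open>x * oct_conj x = oct_conj x * x = nrm x\<close> (as a multiple of the unit),
  this is the inverse of any nonzero \<open>x\<close>.\<close>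

definition oct_inv :: "('k::field, 'a::ab_group_add) normed_alg \<Rightarrow> 'a \<Rightarrow> 'a" where
  "oct_inv A x = scl A (inverse (nrm A x)) (oct_conj A x)"

section \<open>The octonion plane\<close>

datatype 'a point = Aff 'a 'a | Slope 'a | PInf
datatype 'a line = Graph 'a 'a | Vert 'a | LInf

fun incident :: "('k::field, 'a::ab_group_add) normed_alg \<Rightarrow> 'a point \<Rightarrow> 'a line \<Rightarrow> bool" where
  "incident A (Aff a b) (Graph m k) = (mul A m a + b = k)"
| "incident A (Aff a b) (Vert l) = (a = l)"
| "incident A (Aff a b) LInf = False"
| "incident A (Slope c) (Graph m k) = (c = m)"
| "incident A (Slope c) (Vert l) = False"
| "incident A (Slope c) LInf = True"
| "incident A PInf (Graph m k) = False"
| "incident A PInf (Vert l) = True"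
| "incident A PInf LInf = True"

definition collineation ::
  "('k::field, 'a::ab_group_add) normed_alg
     \<Rightarrow> ('a point \<Rightarrow> 'a point) \<times> ('a line \<Rightarrow> 'a line) \<Rightarrow> bool" where
  "collineation A g \<longleftrightarrow> bij (fst g) \<and> bij (snd g) \<and>
     (\<forall>p l. incident A (fst g p) (snd g l) \<longleftrightarrow> incident A p l)"

text \<open>In the plane, a root is a path \<open>x\<^sub>0, x\<^sub>1, x\<^sub>2, x\<^sub>3\<close> in the incidence graph, and its
  root group fixes everything incident with \<open>x\<^sub>1\<close> or \<open>x\<^sub>2\<close>. One of these is a point \<open>c\<close>
  (the center) and the other a line \<open>l\<close> (the axis), and the group depends only on these.\<close>

definition plane_root_group ::
  "('k::field, 'a::ab_group_add) normed_alg \<Rightarrow> 'a point \<Rightarrow> 'a line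
     \<Rightarrow> (('a point \<Rightarrow> 'a point) \<times> ('a line \<Rightarrow> 'a line)) set" where
  "plane_root_group A c l =
     {g. collineation A g \<and> (\<forall>p. incident A p l \<longrightarrow> fst g p = p)
                          \<and> (\<forall>m. incident A c m \<longrightarrow> snd g m = m)}"

text \<open>An apartment (triangle) through the flag \<open>(p, l)\<close> is recorded by its second vertex \<open>q\<close>
  on \<open>l\<close> and its second side \<open>m\<close> through \<open>p\<close>. The third vertex on \<open>m\<close> and the third side
  do not influence the root groups of the three roots containing the flag, the
  interiors of which are \<open>(q, l)\<close>, \<open>(p, l)\<close> and \<open>(p, m)\<close>.\<close>

definition apartment_through ::
  "('k::field, 'a::ab_group_add) normed_alg \<Rightarrow> 'a point \<Rightarrow> 'a line
     \<Rightarrow> 'a point \<times> 'a line \<Rightarrow> bool" where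
  "apartment_through A p l qm \<longleftrightarrow> incident A p l \<and>
     incident A (fst qm) l \<and> fst qm \<noteq> p \<and> incident A p (snd qm) \<and> snd qm \<noteq> l"

definition flag_root_product ::
  "('k::field, 'a::ab_group_add) normed_alg \<Rightarrow> 'a point \<Rightarrow> 'a line \<Rightarrow> 'a point \<times> 'a line
     \<Rightarrow> (('a point \<Rightarrow> 'a point) \<times> ('a line \<Rightarrow> 'a line)) set" where
  "flag_root_product A p l qm =
     {(fst g1 \<circ> fst g2 \<circ> fst g3, snd g1 \<circ> snd g2 \<circ> snd g3) | g1 g2 g3.
        g1 \<in> plane_root_group A (fst qm) l \<and> g2 \<in> plane_root_group A p l \<and>
        g3 \<in> plane_root_group A p (snd qm)}"

section \<open>Polarities of type IV\<close>

text \<open>As the algebra is the direct sum of \<open>D\<close> and \<open>D z\<close>, the last clause determines \<open>\<eta>\<close>.\<close>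

definition type_IV_automorphism ::
  "('k::field, 'a::ab_group_add) normed_alg \<Rightarrow> 'a set \<Rightarrow> 'a \<Rightarrow> ('a \<Rightarrow> 'a) \<Rightarrow> bool" where
  "type_IV_automorphism A D z \<eta> \<longleftrightarrow>
     module.subspace (scl A) D \<and> vector_space.dim (scl A) D = 4 \<and>
     unt A \<in> D \<and> (\<forall>x\<in>D. \<forall>y\<in>D. mul A x y \<in> D) \<and>
     (\<forall>x\<in>D. \<forall>y\<in>D. polar A x y = 0) \<and>
     z \<notin> D \<and> oct_trace A z = unt A \<and>
     (\<forall>d\<in>D. \<forall>d'\<in>D. \<eta> (d + mul A d' z) = d + mul A d' (oct_conj A z))"

fun polarity_point ::
  "('k::field, 'a::ab_group_add) normed_alg \<Rightarrow> ('a \<Rightarrow> 'a) \<Rightarrow> 'a point \<Rightarrow> 'a line" where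
  "polarity_point A \<eta> (Aff a b) = Graph (\<eta> (oct_conj A a)) (- \<eta> (oct_conj A b))"
| "polarity_point A \<eta> (Slope c) = Vert (\<eta> (oct_conj A c))"
| "polarity_point A \<eta> PInf = LInf"

text \<open>The inverse of the previous map, since \<open>x \<mapsto> \<eta> (oct_conj x)\<close> is an additive involution.\<close>

fun polarity_line ::
  "('k::field, 'a::ab_group_add) normed_alg \<Rightarrow> ('a \<Rightarrow> 'a) \<Rightarrow> 'a line \<Rightarrow> 'a point" where
  "polarity_line A \<eta> (Graph m k) = Aff (\<eta> (oct_conj A m)) (- \<eta> (oct_conj A k))"
| "polarity_line A \<eta> (Vert l) = Slope (\<eta> (oct_conj A l))"
| "polarity_line A \<eta> LInf = PInf"

definition commutes_with_polarity ::
  "('k::field, 'a::ab_group_add) normed_alg \<Rightarrow> ('a \<Rightarrow> 'a)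
     \<Rightarrow> ('a point \<Rightarrow> 'a point) \<times> ('a line \<Rightarrow> 'a line) \<Rightarrow> bool" where
  "commutes_with_polarity A \<eta> g \<longleftrightarrow>
     (\<forall>p. polarity_point A \<eta> (fst g p) = snd g (polarity_point A \<eta> p)) \<and>
     (\<forall>l. polarity_line A \<eta> (snd g l) = fst g (polarity_line A \<eta> l))"

definition absolute_points ::
  "('k::field, 'a::ab_group_add) normed_alg \<Rightarrow> ('a \<Rightarrow> 'a) \<Rightarrow> 'a point set" where
  "absolute_points A \<eta> = {p. incident A p (polarity_point A \<eta> p)}"

section \<open>Moufang sets\<close>

text \<open>Permutations of a set are represented as in \<^const>\<open>BijGroup\<close>. Moufang sets are
  written with actions on the right, so \<open>U\<^sup>\<phi> = \<phi>\<^sup>-\<^sup>1 U \<phi>\<close> reads \<open>\<phi> \<circ> U \<circ> \<phi>\<^sup>-\<^sup>1\<close> here.\<close>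

record 'x root_system =
  points :: "'x set"
  rootgrp :: "'x \<Rightarrow> ('x \<Rightarrow> 'x) set"

definition conj_set :: "'x set \<Rightarrow> ('x \<Rightarrow> 'x) set \<Rightarrow> ('x \<Rightarrow> 'x) \<Rightarrow> ('x \<Rightarrow> 'x) set" where
  "conj_set X H \<phi> = (\<lambda>u. \<phi> \<otimes>\<^bsub>BijGroup X\<^esub> u \<otimes>\<^bsub>BijGroup X\<^esub> inv\<^bsub>BijGroup X\<^esub> \<phi>) ` H"

definition moufang_set :: "'x root_system \<Rightarrow> bool" where
  "moufang_set M \<longleftrightarrow>
     (\<forall>x\<in>points M. subgroup (rootgrp M x) (BijGroup (points M)) \<and>
        (\<forall>u\<in>rootgrp M x. u x = x) \<and>
        (\<forall>y\<in>points M - {x}. \<forall>y'\<in>points M - {x}. \<exists>!u. u \<in> rootgrp M x \<and> u y = y')) \<and>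
     (\<forall>x\<in>points M. \<forall>\<phi>\<in>generate (BijGroup (points M)) (\<Union>y\<in>points M. rootgrp M y).
        conj_set (points M) (rootgrp M x) \<phi> = rootgrp M (\<phi> x))"

definition moufang_isomorphic :: "'x root_system \<Rightarrow> 'y root_system \<Rightarrow> bool" where
  "moufang_isomorphic M M' \<longleftrightarrow> moufang_set M \<and> moufang_set M' \<and>
     (\<exists>\<beta>. bij_betw \<beta> (points M) (points M') \<and>
        (\<forall>x\<in>points M.
           (\<lambda>u. \<lambda>y\<in>points M'. \<beta> (u (inv_into (points M) \<beta> y))) ` rootgrp M x
             = rootgrp M' (\<beta> x)))"

text \<open>The construction \<open>M(U, \<tau>)\<close>, with \<^term>\<open>None\<close> for the point at infinity. Only the
  values of \<open>\<tau>\<close> on non-identity elements are used.\<close>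

definition mu_points :: "('a, 'b) monoid_scheme \<Rightarrow> 'a option set" where
  "mu_points G = insert None (Some ` carrier G)"

definition mu_alpha :: "('a, 'b) monoid_scheme \<Rightarrow> 'a \<Rightarrow> 'a option \<Rightarrow> 'a option" where
  "mu_alpha G a = (\<lambda>x\<in>mu_points G. map_option (\<lambda>y. y \<otimes>\<^bsub>G\<^esub> a) x)"

definition mu_tau :: "('a, 'b) monoid_scheme \<Rightarrow> ('a \<Rightarrow> 'a) \<Rightarrow> 'a option \<Rightarrow> 'a option" where
  "mu_tau G \<tau> = (\<lambda>x\<in>mu_points G. case x of None \<Rightarrow> Some \<one>\<^bsub>G\<^esub>
     | Some y \<Rightarrow> if y = \<one>\<^bsub>G\<^esub> then None else Some (\<tau> y))"

definition mu_set :: "('a, 'b) monoid_scheme \<Rightarrow> ('a \<Rightarrow> 'a) \<Rightarrow> 'a option root_system" where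
  "mu_set G \<tau> =
     (let X = mu_points G; Uinf = mu_alpha G ` carrier G; U0 = conj_set X Uinf (mu_tau G \<tau>)
      in \<lparr>points = X,
          rootgrp = (\<lambda>x. case x of None \<Rightarrow> Uinf | Some a \<Rightarrow> conj_set X U0 (mu_alpha G a))\<rparr>)"

definition additive_group :: "'a::ab_group_add set \<Rightarrow> 'a monoid" where
  "additive_group V = \<lparr>carrier = V, mult = (+), one = 0\<rparr>"

definition projective_tau :: "('k::field, 'a::ab_group_add) normed_alg \<Rightarrow> 'a \<Rightarrow> 'a" where
  "projective_tau A x = - oct_inv A x"

text \<open>The Moufang subsets of the projective Moufang set, which itself is
  \<open>mu_set (additive_group UNIV) (projective_tau A)\<close>.\<close>

definition projective_moufang_subset ::
  "('k::field, 'a::ab_group_add) normed_alg \<Rightarrow> 'a option root_system \<Rightarrow> bool" where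
  "projective_moufang_subset A M \<longleftrightarrow>
     (\<exists>V. subgroup V (additive_group UNIV) \<and> projective_tau A ` (V - {0}) = V - {0} \<and>
          M = mu_set (additive_group V) (projective_tau A))"

text \<open>The Moufang set associated to a polarity; \<open>apt\<close> selects, for each absolute point, the
  apartment used to form the product of root groups.\<close>

definition polarity_moufang_set ::
  "('k::field, 'a::ab_group_add) normed_alg \<Rightarrow> ('a \<Rightarrow> 'a)
     \<Rightarrow> ('a point \<Rightarrow> 'a point \<times> 'a line) \<Rightarrow> 'a point root_system" where
  "polarity_moufang_set A \<eta> apt =
     \<lparr>points = absolute_points A \<eta>,
      rootgrp = (\<lambda>x. {restrict (fst g) (absolute_points A \<eta>) | g.
        g \<in> flag_root_product A x (polarity_point A \<eta> x) (apt x) \<and>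
        commutes_with_polarity A \<eta> g})\<rparr>"

end

theory Submission
  imports Defs
begin

text \<open>
  Put \<open>\<sigma> x = \<eta> (cj x)\<close>, an involutory anti-automorphism. An affine point \<open>(a, b)\<close> is absolute if
  and only if \<open>\<sigma>(a) a + b + \<sigma> b = 0\<close>. In characteristic 2 the elements \<open>b + \<sigma> b\<close> form only the
  part of \<open>D\<close> orthogonal to \<open>z\<close>, and anisotropy of the norm shows that \<open>\<sigma>(a) a\<close> meets this
  space only for \<open>a = 0\<close> (\<open>hermitian_anisotropic\<close>). So the hermitian curve collapses to the
  vertical line: the absolute points are \<open>\<infinity>\<close> and the points \<open>(0, b)\<close> with \<open>b\<close> in the fixed space
  \<open>V\<close> of \<open>\<sigma>\<close>, which is \<open>D + k z\<close> and has dimension 5.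

  On this line the isomorphism forgets the zero coordinate. For the flag at infinity, an element
  of the product of the three root groups that preserves the absolute points acts on them as a
  translation, whatever apartment is used (\<open>flag_root_product_at_infinity\<close>). Every other
  absolute point is the image of \<open>\<infinity>\<close> under a collineation commuting with the polarity, namely
  the inversion \<open>(a, b) \<mapsto> (a b\<^sup>-\<^sup>1, b\<^sup>-\<^sup>1)\<close> followed by a translation, and on the second coordinate
  these collineations are exactly the maps \<open>y \<mapsto> y\<^sup>-\<^sup>1\<close> and \<open>y \<mapsto> y + b\<close> from which \<open>M(V, \<tau>)\<close>
  is built. That inversion is a collineation rests on the middle Moufang identity
  (\<open>inversion_identity\<close>); that it commutes with the polarity needs \<open>\<sigma>\<close> to reverse products
  (\<open>eta_mul\<close>).

  The Moufang property itself is checked on the side of \<open>M(V, \<tau>)\<close> and transported. It amounts to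
  the Hua maps of \<open>V\<close> being affine, and these have an explicit expression through the norm form
  (\<open>hua_identity\<close>).
\<close>

section \<open>Composition algebra identities\<close>

locale octonion_algebra =
  fixes A :: "('k::field, 'a::ab_group_add) normed_alg"
  assumes octonion: "octonion_division_algebra A"
begin

abbreviation scale_by (infixr "\<odot>" 75) where "c \<odot> x \<equiv> scl A c x"
abbreviation times_oct (infixl "\<cdot>" 70) where "x \<cdot> y \<equiv> mul A x y"
abbreviation "\<e> \<equiv> unt A"
abbreviation "N \<equiv> nrm A"
abbreviation "B \<equiv> polar A"
abbreviation "cj \<equiv> oct_conj A"
abbreviation "oinv \<equiv> oct_inv A"

sublocale vector_space "scl A"
  using octonion by (simp add: octonion_division_algebra_def)

lemma dim_UNIV_eq: "dim UNIV = 8"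
  using octonion by (simp add: octonion_division_algebra_def)

lemma mul_hom:
  "(x + y) \<cdot> w = x \<cdot> w + y \<cdot> w" "w \<cdot> (x + y) = w \<cdot> x + w \<cdot> y"
  "(x - y) \<cdot> w = x \<cdot> w - y \<cdot> w" "w \<cdot> (x - y) = w \<cdot> x - w \<cdot> y"
  "(- x) \<cdot> w = - (x \<cdot> w)" "w \<cdot> (- x) = - (w \<cdot> x)"
  "(c \<odot> x) \<cdot> w = c \<odot> (x \<cdot> w)" "w \<cdot> (c \<odot> x) = c \<odot> (w \<cdot> x)"
  and mul_zero [simp]: "0 \<cdot> w = 0" "w \<cdot> 0 = 0"
proof -
  interpret left: Vector_Spaces.linear "scl A" "scl A" "\<lambda>x. x \<cdot> w"
    using octonion by (simp add: octonion_division_algebra_def)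
  interpret right: Vector_Spaces.linear "scl A" "scl A" "\<lambda>x. w \<cdot> x"
    using octonion by (simp add: octonion_division_algebra_def)
  show "(x + y) \<cdot> w = x \<cdot> w + y \<cdot> w" "w \<cdot> (x + y) = w \<cdot> x + w \<cdot> y"
    "(x - y) \<cdot> w = x \<cdot> w - y \<cdot> w" "w \<cdot> (x - y) = w \<cdot> x - w \<cdot> y"
    "(- x) \<cdot> w = - (x \<cdot> w)" "w \<cdot> (- x) = - (w \<cdot> x)"
    "(c \<odot> x) \<cdot> w = c \<odot> (x \<cdot> w)" "w \<cdot> (c \<odot> x) = c \<odot> (w \<cdot> x)"
    "0 \<cdot> w = 0" "w \<cdot> 0 = 0"
    by (simp_all add: left.add right.add left.diff right.diff left.neg right.neg
        left.scale right.scale left.zero right.zero)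
qed

lemma polar_commute: "B x y = B y x"
  by (simp add: polar_def add.commute)

lemma polar_hom_left:
  "B (x + y) w = B x w + B y w" "B (c \<odot> x) w = c * B x w"
  "B (x - y) w = B x w - B y w" "B (- x) w = - B x w"
  and polar_zero_left [simp]: "B 0 w = 0"
proof -
  interpret Vector_Spaces.linear "scl A" "(*)" "\<lambda>x. B x w"
    using octonion by (simp add: octonion_division_algebra_def)
  show "B (x + y) w = B x w + B y w" "B (c \<odot> x) w = c * B x w"
    "B (x - y) w = B x w - B y w" "B (- x) w = - B x w" "B 0 w = 0"
    by (simp_all add: add scale diff neg)
qed

lemma polar_zero_right [simp]: "B x 0 = 0"
  using polar_zero_left polar_commute by metis

lemma polar_hom_right: "B x (y + w) = B x y + B x w" "B x (c \<odot> y) = c * B x y"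
    "B x (y - w) = B x y - B x w" "B x (- y) = - B x y"
  using polar_hom_left(1)[of y w x] polar_hom_left(2)[of c y x] polar_hom_left(3)[of y w x]
    polar_hom_left(4)[of y x] by (simp_all only: polar_commute[of x])

lemmas polar_hom = polar_hom_left polar_hom_right

lemma mul_one [simp]: "\<e> \<cdot> x = x" "x \<cdot> \<e> = x"
  using octonion by (auto simp: octonion_division_algebra_def)

lemma nrm_scale: "N (c \<odot> x) = c\<^sup>2 * N x"
  using octonion by (auto simp: octonion_division_algebra_def)

lemma polar_eqI: "(\<And>u. B x u = B y u) \<Longrightarrow> x = y"
proof -
  assume "\<And>u. B x u = B y u"
  then have "B (x - y) u = 0" for u
    by (simp add: polar_hom)
  then have "x - y = 0"
    using octonion unfolding octonion_division_algebra_def by blast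
  then show ?thesis by simp
qed

lemma nrm_mul: "N (x \<cdot> y) = N x * N y"
  using octonion by (auto simp: octonion_division_algebra_def)

lemma nrm_zero [simp]: "N 0 = 0"
  using nrm_scale[of 0 0] by simp

lemma nrm_eq_zero [simp]: "N x = 0 \<longleftrightarrow> x = 0"
  using octonion nrm_zero by (auto simp: octonion_division_algebra_def)

lemma nrm_add: "N (x + y) = N x + N y + B x y"
  by (simp add: polar_def)

lemma one_nonzero: "\<e> \<noteq> 0"
proof
  assume "\<e> = 0"
  then have "x = 0" for x :: 'a
    by (metis mul_one(1) mul_zero(1))
  then have "UNIV = {0::'a}"
    by auto
  then have "dim UNIV = 0"
    using dim_le_card[of UNIV "{}"] by simp
  then show False
    using dim_UNIV_eq by simp
qed

lemma nrm_one [simp]: "N \<e> = 1"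
  using nrm_mul[of \<e> \<e>] one_nonzero by simp

lemma polar_self: "B x x = 2 * N x"
  using nrm_scale[of 2 x] scale_left_distrib[of 1 1 x] by (simp add: polar_def)

lemma nrm_minus [simp]: "N (- x) = N x"
  using nrm_scale[of "-1" x] by simp

lemma nrm_diff: "N (x - y) = N x + N y - B x y"
  using nrm_add[of x "-y"] by (simp add: polar_hom)

lemma polar_mul_left: "B (x \<cdot> y) (x \<cdot> w) = N x * B y w"
  by (simp add: polar_def mul_hom[symmetric] nrm_mul algebra_simps)

lemma polar_mul_right: "B (y \<cdot> x) (w \<cdot> x) = B y w * N x"
  by (simp add: polar_def mul_hom[symmetric] nrm_mul algebra_simps)

lemma polar_mul_cross: "B (x \<cdot> y) (u \<cdot> w) + B (u \<cdot> y) (x \<cdot> w) = B x u * B y w"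
  using polar_mul_left[of "x + u" y w]
  by (simp add: polar_hom mul_hom nrm_add polar_mul_left polar_commute[of u x] algebra_simps)

text \<open>Conjugation is designed so that left and right multiplications by \<open>x\<close> and by
  \<open>cj x\<close> are adjoint; all the weak associativity used below follows from this and
  nondegeneracy.\<close>

lemma polar_adjoint_left: "B (x \<cdot> y) w = B y (cj x \<cdot> w)"
  using polar_mul_cross[of x y \<e> w]
  by (simp add: oct_conj_def polar_hom mul_hom algebra_simps)

lemma polar_adjoint_right: "B (x \<cdot> y) w = B x (w \<cdot> cj y)"
  using polar_mul_cross[of x y w \<e>]
  by (simp add: oct_conj_def polar_hom mul_hom algebra_simps polar_commute)

lemma cj_hom: "cj (x + y) = cj x + cj y" "cj (x - y) = cj x - cj y"
    "cj (- x) = - cj x" "cj (c \<odot> x) = c \<odot> cj x"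
  by (simp_all add: oct_conj_def polar_hom algebra_simps scale_left_distrib
      scale_left_diff_distrib scale_right_diff_distrib)

lemma cj_zero [simp]: "cj 0 = 0"
  by (simp add: oct_conj_def)

lemma cj_one [simp]: "cj \<e> = \<e>"
  using scale_left_distrib[of 1 1 \<e>]  by (simp add: oct_conj_def polar_self)

lemma cj_cj [simp]: "cj (cj x) = x"
  by (simp add: oct_conj_def[of A x] cj_hom)

lemma nrm_cj [simp]: "N (cj x) = N x"
  by (simp add: oct_conj_def nrm_diff nrm_scale polar_hom power2_eq_square polar_commute)

lemma polar_cj: "B (cj x) (cj y) = B x y"
  by (simp add: polar_def cj_hom[symmetric])

lemma polar_cj_right: "B x (cj y) = B (cj x) y"
  using polar_cj[of x "cj y"] by simp

lemma cj_mul_cancel_left: "cj x \<cdot> (x \<cdot> y) = N x \<odot> y" "x \<cdot> (cj x \<cdot> y) = N x \<odot> y"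
proof -
  have "cj x \<cdot> (x \<cdot> y) = N x \<odot> y" for x
    by (rule polar_eqI) (simp add: polar_adjoint_left[of "cj x" for x] polar_hom polar_mul_left)
  from this[of x] this[of "cj x"] show "cj x \<cdot> (x \<cdot> y) = N x \<odot> y" "x \<cdot> (cj x \<cdot> y) = N x \<odot> y"
    by simp_all
qed

lemma cj_mul_cancel_right: "(y \<cdot> x) \<cdot> cj x = N x \<odot> y" "(y \<cdot> cj x) \<cdot> x = N x \<odot> y"
proof -
  have "(y \<cdot> x) \<cdot> cj x = N x \<odot> y" for x
    by (rule polar_eqI) (simp add: polar_adjoint_right[of _ "cj x" for x] polar_hom polar_mul_right)
  from this[of x] this[of "cj x"] show "(y \<cdot> x) \<cdot> cj x = N x \<odot> y" "(y \<cdot> cj x) \<cdot> x = N x \<odot> y"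
    by simp_all
qed

lemma cj_mul: "cj (x \<cdot> y) = cj y \<cdot> cj x"
proof (rule polar_eqI)
  fix u
  have "B (cj y \<cdot> cj x) u = B (cj x) (y \<cdot> u)"
    by (simp add: polar_adjoint_left)
  also have "\<dots> = B (y \<cdot> u) (cj x)"
    by (rule polar_commute)
  also have "\<dots> = B y (cj x \<cdot> cj u)"
    by (rule polar_adjoint_right)
  also have "\<dots> = B (x \<cdot> y) (cj u)"
    by (simp add: polar_adjoint_left)
  also have "\<dots> = B (cj (x \<cdot> y)) u"
    by (rule polar_cj_right)
  finally show "B (cj (x \<cdot> y)) u = B (cj y \<cdot> cj x) u" ..
qed

lemma left_alternative_linearized:
  "x \<cdot> (cj y \<cdot> w) + y \<cdot> (cj x \<cdot> w) = B x y \<odot> w"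
  using cj_mul_cancel_left(2)[of "x + y" w]
  by (simp add: mul_hom cj_hom cj_mul_cancel_left nrm_add scale_left_distrib algebra_simps)

lemma right_alternative_linearized:
  "(w \<cdot> cj x) \<cdot> y + (w \<cdot> cj y) \<cdot> x = B x y \<odot> w"
  using cj_mul_cancel_right(2)[of w "x + y"]
  by (simp add: mul_hom cj_hom cj_mul_cancel_right nrm_add scale_left_distrib algebra_simps)

text \<open>The middle Moufang identity \<open>(x y) (w x) = x (y w) x\<close>, with the right-hand side
  rewritten by \<open>x u x = B x (cj u) x - N x cj u\<close>.\<close>

lemma middle_moufang:
  "(x \<cdot> y) \<cdot> (w \<cdot> x) = B x (cj (y \<cdot> w)) \<odot> x - N x \<odot> cj (y \<cdot> w)"
proof (rule polar_eqI)
  fix u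
  have "B ((x \<cdot> y) \<cdot> (w \<cdot> x)) u = B (x \<cdot> y) (u \<cdot> (cj x \<cdot> cj w))"
    by (simp add: polar_adjoint_right cj_mul)
  also have "\<dots> = B x u * B y (cj x \<cdot> cj w) - B (u \<cdot> y) (x \<cdot> (cj x \<cdot> cj w))"
    using polar_mul_cross[of x y u "cj x \<cdot> cj w"] by (simp add: algebra_simps)
  also have "B (u \<cdot> y) (x \<cdot> (cj x \<cdot> cj w)) = N x * B u (cj (y \<cdot> w))"
    by (simp add: cj_mul_cancel_left polar_hom polar_adjoint_right cj_mul)
  also have "B y (cj x \<cdot> cj w) = B x (cj (y \<cdot> w))"
    by (metis polar_adjoint_left polar_adjoint_right cj_mul)
  finally show "B ((x \<cdot> y) \<cdot> (w \<cdot> x)) u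
      = B (B x (cj (y \<cdot> w)) \<odot> x - N x \<odot> cj (y \<cdot> w)) u"
    by (simp add: polar_hom polar_commute)
qed

lemma oinv_cancel:
  assumes "x \<noteq> 0"
  shows "x \<cdot> (oinv x \<cdot> y) = y" "oinv x \<cdot> (x \<cdot> y) = y"
    "(y \<cdot> x) \<cdot> oinv x = y" "(y \<cdot> oinv x) \<cdot> x = y"
  using assms by (simp_all add: oct_inv_def mul_hom cj_mul_cancel_left cj_mul_cancel_right)

lemma nrm_oinv: "N (oinv x) = inverse (N x)"
  by (cases "x = 0") (simp_all add: oct_inv_def nrm_scale power2_eq_square)

lemma oinv_eq_zero [simp]: "oinv x = 0 \<longleftrightarrow> x = 0"
  by (metis nrm_oinv nrm_eq_zero inverse_nonzero_iff_nonzero)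

lemma oinv_oinv [simp]: "oinv (oinv x) = x"
  by (cases "x = 0") (simp_all add: oct_inv_def nrm_scale cj_hom power2_eq_square field_simps)

lemma mul_eq_zero [simp]: "x \<cdot> y = 0 \<longleftrightarrow> x = 0 \<or> y = 0"
  by (metis nrm_mul nrm_eq_zero mult_eq_0_iff)

end

section \<open>Moufang sets from one root group and its conjugates\<close>

lemma carrier_BijGroup [simp]: "carrier (BijGroup X) = Bij X"
  by (simp add: BijGroup_def)

lemma BijGroup_mult_apply:
  "f \<in> Bij X \<Longrightarrow> g \<in> Bij X \<Longrightarrow> x \<in> X \<Longrightarrow> (f \<otimes>\<^bsub>BijGroup X\<^esub> g) x = f (g x)"
  by (simp add: BijGroup_def compose_def)

lemma BijGroup_one_apply: "x \<in> X \<Longrightarrow> \<one>\<^bsub>BijGroup X\<^esub> x = x"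
  by (simp add: BijGroup_def)

lemma Bij_apply: "f \<in> Bij X \<Longrightarrow> x \<in> X \<Longrightarrow> f x \<in> X"
  using Bij_imp_funcset by blast

lemma Bij_eqI: "f \<in> Bij X \<Longrightarrow> g \<in> Bij X \<Longrightarrow> (\<And>x. x \<in> X \<Longrightarrow> f x = g x) \<Longrightarrow> f = g"
  by (rule extensionalityI[of _ X]) (auto simp: Bij_def)

lemma BijGroup_inv_apply:
  assumes "f \<in> Bij X" "x \<in> X"
  shows "(inv\<^bsub>BijGroup X\<^esub> f) (f x) = x" "f ((inv\<^bsub>BijGroup X\<^esub> f) x) = x"
proof -
  interpret group "BijGroup X" by (rule group_BijGroup)
  have inv: "inv\<^bsub>BijGroup X\<^esub> f \<in> Bij X"
    using inv_closed assms by simp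
  show "(inv\<^bsub>BijGroup X\<^esub> f) (f x) = x" "f ((inv\<^bsub>BijGroup X\<^esub> f) x) = x"
    using l_inv[of f] r_inv[of f] assms inv
    by (metis BijGroup_mult_apply BijGroup_one_apply carrier_BijGroup)+
qed

lemma conj_set_subset:
  assumes "H \<subseteq> Bij X" "\<phi> \<in> Bij X"
  shows "conj_set X H \<phi> \<subseteq> Bij X"
proof -
  interpret group "BijGroup X" by (rule group_BijGroup)
  have "\<phi> \<otimes>\<^bsub>BijGroup X\<^esub> u \<otimes>\<^bsub>BijGroup X\<^esub> inv\<^bsub>BijGroup X\<^esub> \<phi> \<in> carrier (BijGroup X)"
    if "u \<in> H" for u
    using assms that by (intro m_closed inv_closed) auto
  then show ?thesis
    by (auto simp: conj_set_def)
qed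

lemma conj_set_mult:
  assumes "H \<subseteq> Bij X" "\<phi> \<in> Bij X" "\<psi> \<in> Bij X"
  shows "conj_set X (conj_set X H \<phi>) \<psi> = conj_set X H (\<psi> \<otimes>\<^bsub>BijGroup X\<^esub> \<phi>)"
proof -
  interpret group "BijGroup X" by (rule group_BijGroup)
  have "\<psi> \<otimes>\<^bsub>BijGroup X\<^esub> (\<phi> \<otimes>\<^bsub>BijGroup X\<^esub> u \<otimes>\<^bsub>BijGroup X\<^esub> inv\<^bsub>BijGroup X\<^esub> \<phi>)
        \<otimes>\<^bsub>BijGroup X\<^esub> inv\<^bsub>BijGroup X\<^esub> \<psi>
      = (\<psi> \<otimes>\<^bsub>BijGroup X\<^esub> \<phi>) \<otimes>\<^bsub>BijGroup X\<^esub> u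
        \<otimes>\<^bsub>BijGroup X\<^esub> inv\<^bsub>BijGroup X\<^esub> (\<psi> \<otimes>\<^bsub>BijGroup X\<^esub> \<phi>)" if "u \<in> H" for u
  proof -
    have "u \<in> carrier (BijGroup X)" "\<phi> \<in> carrier (BijGroup X)" "\<psi> \<in> carrier (BijGroup X)"
      using assms that by auto
    then show ?thesis
      by (simp only: inv_mult_group m_assoc m_closed inv_closed)
  qed
  then show ?thesis
    unfolding conj_set_def image_image by (intro image_cong refl)
qed

lemma conj_set_one:
  assumes "H \<subseteq> Bij X"
  shows "conj_set X H \<one>\<^bsub>BijGroup X\<^esub> = H"
proof -
  interpret group "BijGroup X" by (rule group_BijGroup)
  have "\<one>\<^bsub>BijGroup X\<^esub> \<otimes>\<^bsub>BijGroup X\<^esub> u \<otimes>\<^bsub>BijGroup X\<^esub> inv\<^bsub>BijGroup X\<^esub> \<one>\<^bsub>BijGroup X\<^esub> = u"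
    if "u \<in> H" for u
    using assms that by (metis carrier_BijGroup inv_one l_one r_one subsetD)
  then show ?thesis
    by (auto simp: conj_set_def)
qed

lemma conj_set_inv:
  assumes "H \<subseteq> Bij X" "\<phi> \<in> Bij X"
  shows "conj_set X (conj_set X H \<phi>) (inv\<^bsub>BijGroup X\<^esub> \<phi>) = H"
proof -
  interpret group "BijGroup X" by (rule group_BijGroup)
  have "inv\<^bsub>BijGroup X\<^esub> \<phi> \<in> Bij X"
    using inv_closed assms by simp
  then show ?thesis
    using assms l_inv[of \<phi>] by (simp add: conj_set_mult conj_set_one)
qed

lemma conj_set_self:
  assumes "subgroup H (BijGroup X)" "\<phi> \<in> H"
  shows "conj_set X H \<phi> = H"
proof -
  interpret group "BijGroup X" by (rule group_BijGroup)
  interpret H: subgroup H "BijGroup X" by fact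
  have sub: "conj_set X H \<psi> \<subseteq> H" if "\<psi> \<in> H" for \<psi>
    using that by (auto simp: conj_set_def)
  have "H \<subseteq> Bij X"
    using H.subset by simp
  moreover have "inv\<^bsub>BijGroup X\<^esub> \<phi> \<in> H"
    using assms by simp
  ultimately have "H = conj_set X (conj_set X H (inv\<^bsub>BijGroup X\<^esub> \<phi>)) \<phi>"
    using conj_set_inv[of H X "inv\<^bsub>BijGroup X\<^esub> \<phi>"] inv_inv[of \<phi>] inv_closed[of \<phi>] \<open>\<phi> \<in> H\<close>
    by (simp add: subset_iff)
  also have "\<dots> \<subseteq> conj_set X H \<phi>"
    using sub[of "inv\<^bsub>BijGroup X\<^esub> \<phi>"] \<open>inv\<^bsub>BijGroup X\<^esub> \<phi> \<in> H\<close> by (auto simp: conj_set_def)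
  finally show ?thesis
    using sub assms by blast
qed

definition is_root_group :: "'x set \<Rightarrow> ('x \<Rightarrow> 'x) set \<Rightarrow> 'x \<Rightarrow> bool" where
  "is_root_group X H x \<longleftrightarrow> subgroup H (BijGroup X) \<and> (\<forall>u\<in>H. u x = x) \<and>
     (\<forall>y\<in>X - {x}. \<forall>y'\<in>X - {x}. \<exists>!u. u \<in> H \<and> u y = y')"

lemma is_root_group_subset: "is_root_group X H x \<Longrightarrow> H \<subseteq> Bij X"
  using subgroup.subset by (fastforce simp: is_root_group_def)

lemma is_root_group_conj:
  assumes H: "is_root_group X H x" and \<phi>: "\<phi> \<in> Bij X" and x: "x \<in> X"
  shows "is_root_group X (conj_set X H \<phi>) (\<phi> x)"
proof -
  interpret group "BijGroup X" by (rule group_BijGroup)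
  interpret H: subgroup H "BijGroup X" using H by (simp add: is_root_group_def)
  let ?i = "inv\<^bsub>BijGroup X\<^esub> \<phi>"
  let ?c = "\<lambda>u. \<phi> \<otimes>\<^bsub>BijGroup X\<^esub> u \<otimes>\<^bsub>BijGroup X\<^esub> ?i"
  have i: "?i \<in> Bij X"
    using inv_closed \<phi> by simp
  have HX: "u \<in> Bij X" if "u \<in> H" for u
    using that H.subset by auto
  have c_apply: "?c u y = \<phi> (u (?i y))" if "u \<in> H" "y \<in> X" for u y
  proof -
    have "\<phi> \<otimes>\<^bsub>BijGroup X\<^esub> u \<in> Bij X"
      using m_closed HX that \<phi> by simp
    then show ?thesis
      using that HX i \<phi> by (simp add: BijGroup_mult_apply Bij_apply)
  qed
  have c_mult: "?c (u \<otimes>\<^bsub>BijGroup X\<^esub> v) = ?c u \<otimes>\<^bsub>BijGroup X\<^esub> ?c v"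
    if "u \<in> carrier (BijGroup X)" "v \<in> carrier (BijGroup X)" for u v
  proof -
    have "\<phi> \<in> carrier (BijGroup X)"
      using \<phi> by simp
    then have "?i \<otimes>\<^bsub>BijGroup X\<^esub> (\<phi> \<otimes>\<^bsub>BijGroup X\<^esub> w) = w" if "w \<in> carrier (BijGroup X)" for w
      using that by (simp only: m_assoc[symmetric] inv_closed l_inv l_one)
    then show ?thesis
      using that \<open>\<phi> \<in> carrier (BijGroup X)\<close> by (simp only: m_assoc m_closed inv_closed)
  qed
  have "?c u \<in> carrier (BijGroup X)" if "u \<in> carrier (BijGroup X)" for u
    using that \<phi> by (intro m_closed inv_closed) auto
  then interpret c: group_hom "BijGroup X" "BijGroup X" ?c
    using c_mult by unfold_locales (auto simp: hom_def simp del: carrier_BijGroup)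
  have "subgroup (conj_set X H \<phi>) (BijGroup X)"
    unfolding conj_set_def by (rule c.subgroup_img_is_subgroup) unfold_locales
  moreover have "f (\<phi> x) = \<phi> x" if f: "f \<in> conj_set X H \<phi>" for f
  proof -
    obtain u where u: "u \<in> H" "f = ?c u"
      using f by (auto simp: conj_set_def)
    moreover from u have "u x = x"
      using H unfolding is_root_group_def by blast
    ultimately show ?thesis
      using x \<phi> by (simp add: c_apply Bij_apply BijGroup_inv_apply)
  qed
  moreover have "\<exists>!f. f \<in> conj_set X H \<phi> \<and> f y = y'"
    if y: "y \<in> X - {\<phi> x}" "y' \<in> X - {\<phi> x}" for y y'
  proof -
    have "?i w \<in> X - {x}" if "w \<in> X - {\<phi> x}" for w
      using that Bij_apply[OF i, of w] BijGroup_inv_apply(2)[OF \<phi>, of w] by auto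
    then have ex1: "\<exists>!u. u \<in> H \<and> u (?i y) = ?i y'"
      using H y unfolding is_root_group_def by blast
    have iff: "?c u y = y' \<longleftrightarrow> u (?i y) = ?i y'" if u: "u \<in> H" for u
    proof -
      have "u (?i y) \<in> X"
        using y Bij_apply[OF i] Bij_apply[OF HX[OF u]] by blast
      then show ?thesis
        using y c_apply[OF u] BijGroup_inv_apply[OF \<phi>] by auto
    qed
    from ex1 obtain u where u: "u \<in> H" "u (?i y) = ?i y'"
        and unique: "\<And>v. v \<in> H \<Longrightarrow> v (?i y) = ?i y' \<Longrightarrow> v = u"
      by blast
    show ?thesis
    proof (rule ex1I[of _ "?c u"])
      show "?c u \<in> conj_set X H \<phi> \<and> ?c u y = y'"
        using u iff by (simp add: conj_set_def)
      show "f = ?c u" if "f \<in> conj_set X H \<phi> \<and> f y = y'" for f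
        using that unique iff unfolding conj_set_def by blast
    qed
  qed
  ultimately show ?thesis
    by (simp add: is_root_group_def)
qed

definition root_automorphisms :: "'x root_system \<Rightarrow> ('x \<Rightarrow> 'x) set" where
  "root_automorphisms M = {\<phi> \<in> Bij (points M).
     \<forall>x\<in>points M. conj_set (points M) (rootgrp M x) \<phi> = rootgrp M (\<phi> x)}"

lemma subgroup_root_automorphisms:
  assumes root: "\<And>x. x \<in> points M \<Longrightarrow> rootgrp M x \<subseteq> Bij (points M)"
  shows "subgroup (root_automorphisms M) (BijGroup (points M))"
proof -
  interpret group "BijGroup (points M)" by (rule group_BijGroup)
  show ?thesis
  proof
    show "root_automorphisms M \<subseteq> carrier (BijGroup (points M))"
      by (auto simp: root_automorphisms_def)
    show "f \<otimes>\<^bsub>BijGroup (points M)\<^esub> g \<in> root_automorphisms M"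
      if "f \<in> root_automorphisms M" "g \<in> root_automorphisms M" for f g
      using that root m_closed[of f g]
      by (simp add: root_automorphisms_def conj_set_mult[symmetric] BijGroup_mult_apply Bij_apply)
    show "\<one>\<^bsub>BijGroup (points M)\<^esub> \<in> root_automorphisms M"
      using root one_closed
      by (simp add: root_automorphisms_def conj_set_one BijGroup_one_apply)
    show "inv\<^bsub>BijGroup (points M)\<^esub> f \<in> root_automorphisms M"
      if f: "f \<in> root_automorphisms M" for f
    proof -
      let ?i = "inv\<^bsub>BijGroup (points M)\<^esub> f"
      have fB: "f \<in> Bij (points M)"
        using f by (simp add: root_automorphisms_def)
      then have i: "?i \<in> Bij (points M)"
        using inv_closed by simp
      have "conj_set (points M) (rootgrp M x) ?i = rootgrp M (?i x)" if x: "x \<in> points M" for x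
      proof -
        have ix: "?i x \<in> points M"
          using i x by (rule Bij_apply)
        then have "conj_set (points M) (rootgrp M (?i x)) f = rootgrp M x"
          using f x by (simp add: root_automorphisms_def BijGroup_inv_apply)
        then show ?thesis
          using conj_set_inv[OF root[OF ix] fB] by simp
      qed
      then show ?thesis
        using i by (simp add: root_automorphisms_def)
    qed
  qed
qed

text \<open>The permutations that permute the root groups form a subgroup, so the condition on the
  group generated by the root groups reduces to one on its generators.\<close>

lemma moufang_set_iff:
  "moufang_set M \<longleftrightarrow> (\<forall>x\<in>points M. is_root_group (points M) (rootgrp M x) x) \<and>
     (\<forall>x\<in>points M. rootgrp M x \<subseteq> root_automorphisms M)"
proof
  assume M: "moufang_set M"
  then have root: "is_root_group (points M) (rootgrp M x) x" if "x \<in> points M" for x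
    using that by (simp add: moufang_set_def is_root_group_def)
  moreover have "\<phi> \<in> root_automorphisms M" if "x \<in> points M" "\<phi> \<in> rootgrp M x" for x \<phi>
  proof -
    have "\<phi> \<in> generate (BijGroup (points M)) (\<Union>y\<in>points M. rootgrp M y)"
      using that by (intro generate.incl) auto
    then have "\<forall>x\<in>points M. conj_set (points M) (rootgrp M x) \<phi> = rootgrp M (\<phi> x)"
      using M by (simp add: moufang_set_def)
    then show ?thesis
      using is_root_group_subset[OF root] that by (auto simp: root_automorphisms_def)
  qed
  ultimately show "(\<forall>x\<in>points M. is_root_group (points M) (rootgrp M x) x) \<and>
     (\<forall>x\<in>points M. rootgrp M x \<subseteq> root_automorphisms M)" by blast
next
  assume R: "(\<forall>x\<in>points M. is_root_group (points M) (rootgrp M x) x) \<and>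
     (\<forall>x\<in>points M. rootgrp M x \<subseteq> root_automorphisms M)"
  then have "subgroup (root_automorphisms M) (BijGroup (points M))"
    by (intro subgroup_root_automorphisms is_root_group_subset) auto
  then have "generate (BijGroup (points M)) (\<Union>y\<in>points M. rootgrp M y) \<subseteq> root_automorphisms M"
    using R by (intro group.generate_subgroup_incl group_BijGroup) auto
  then show "moufang_set M"
    using R by (auto simp: moufang_set_def is_root_group_def root_automorphisms_def)
qed

subsection \<open>Transport along a bijection\<close>

text \<open>Conjugation by \<open>\<beta>\<close> is an injective homomorphism between the permutation groups. As it maps
  root groups onto root groups, every identity between conjugates of root groups can be checked
  after applying it.\<close>

lemma moufang_set_transport:
  fixes M :: "'x root_system" and M' :: "'y root_system"
  assumes M': "moufang_set M'"
    and \<beta>: "bij_betw \<beta> (points M) (points M')"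
    and sub: "\<And>x. x \<in> points M \<Longrightarrow> rootgrp M x \<subseteq> Bij (points M)"
    and root: "\<And>x. x \<in> points M \<Longrightarrow>
      (\<lambda>u. \<lambda>y\<in>points M'. \<beta> (u (inv_into (points M) \<beta> y))) ` rootgrp M x = rootgrp M' (\<beta> x)"
  shows "moufang_isomorphic M M'"
proof -
  define X Y where "X = points M" and "Y = points M'"
  define T where "T u = (\<lambda>y\<in>Y. \<beta> (u (inv_into X \<beta> y)))" for u
  interpret X: group "BijGroup X" by (rule group_BijGroup)
  interpret Y: group "BijGroup Y" by (rule group_BijGroup)
  have bij: "bij_betw \<beta> X Y"
    using \<beta> by (simp add: X_def Y_def)
  have T_apply: "T u (\<beta> x) = \<beta> (u x)" if "x \<in> X" for u x
    using that bij by (simp add: T_def bij_betw_inv_into_left bij_betwE)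
  have image: "\<exists>x\<in>X. y = \<beta> x" if "y \<in> Y" for y
    using bij that by (auto simp: bij_betw_def)
  have \<beta>_in: "\<beta> x \<in> Y" if "x \<in> X" for x
    using bij that by (rule bij_betwE[THEN bspec])
  have \<beta>_inj: "\<beta> x = \<beta> x' \<longleftrightarrow> x = x'" if "x \<in> X" "x' \<in> X" for x x'
    using bij that by (auto simp: bij_betw_def inj_on_def)
  have T_Bij: "T u \<in> Bij Y" if u: "u \<in> Bij X" for u
  proof -
    have "bij_betw (\<beta> \<circ> u \<circ> inv_into X \<beta>) Y Y"
      using bij u by (intro bij_betw_trans[of _ Y X] bij_betw_inv_into bij_betw_trans[of _ X X])
        (auto simp: Bij_def)
    then have "bij_betw (T u) Y Y"
      by (rule bij_betw_cong[THEN iffD1, rotated]) (simp add: T_def)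
    then show ?thesis
      by (simp add: Bij_def T_def)
  qed
  have T_inj: "inj_on T (Bij X)"
  proof (rule inj_onI)
    fix u v assume uv: "u \<in> Bij X" "v \<in> Bij X" "T u = T v"
    then show "u = v"
      by (intro Bij_eqI[of u X v]) (auto simp flip: T_apply \<beta>_inj simp: Bij_apply)
  qed
  have T_mult: "T (u \<otimes>\<^bsub>BijGroup X\<^esub> v) = T u \<otimes>\<^bsub>BijGroup Y\<^esub> T v"
    if "u \<in> Bij X" "v \<in> Bij X" for u v
  proof (rule Bij_eqI[of _ Y])
    show "T (u \<otimes>\<^bsub>BijGroup X\<^esub> v) \<in> Bij Y" "T u \<otimes>\<^bsub>BijGroup Y\<^esub> T v \<in> Bij Y"
      using that T_Bij X.m_closed[of u v] Y.m_closed[of "T u" "T v"] by auto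
    fix y assume "y \<in> Y"
    then show "T (u \<otimes>\<^bsub>BijGroup X\<^esub> v) y = (T u \<otimes>\<^bsub>BijGroup Y\<^esub> T v) y"
      using image[of y] that by (auto simp: BijGroup_mult_apply T_Bij T_apply Bij_apply \<beta>_in)
  qed
  interpret T: group_hom "BijGroup X" "BijGroup Y" T
    by unfold_locales (auto simp: hom_def T_Bij T_mult)
  have subX: "rootgrp M x \<subseteq> Bij X" if "x \<in> X" for x
    using sub that by (simp add: X_def)
  have image_root: "T ` rootgrp M x = rootgrp M' (\<beta> x)" if "x \<in> X" for x
    using root[of x] that unfolding T_def[abs_def] X_def Y_def by simp
  have root': "is_root_group Y (rootgrp M' (\<beta> x)) (\<beta> x)" "rootgrp M' (\<beta> x) \<subseteq> root_automorphisms M'"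
    if "x \<in> X" for x
    using M' \<beta>_in[OF that] by (auto simp: moufang_set_iff Y_def)
  have T_image_conj: "T ` conj_set X H \<phi> = conj_set Y (T ` H) (T \<phi>)"
    if "H \<subseteq> Bij X" "\<phi> \<in> Bij X" for H \<phi>
  proof -
    have "T (\<phi> \<otimes>\<^bsub>BijGroup X\<^esub> u \<otimes>\<^bsub>BijGroup X\<^esub> inv\<^bsub>BijGroup X\<^esub> \<phi>)
        = T \<phi> \<otimes>\<^bsub>BijGroup Y\<^esub> T u \<otimes>\<^bsub>BijGroup Y\<^esub> inv\<^bsub>BijGroup Y\<^esub> T \<phi>" if "u \<in> H" for u
    proof -
      have "u \<in> carrier (BijGroup X)" "\<phi> \<in> carrier (BijGroup X)"
        using that \<open>H \<subseteq> Bij X\<close> \<open>\<phi> \<in> Bij X\<close> by auto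
      then show ?thesis
        by (simp only: T.hom_mult X.m_closed X.inv_closed T.hom_inv)
    qed
    then show ?thesis
      unfolding conj_set_def image_image by (intro image_cong refl)
  qed
  have "is_root_group X (rootgrp M x) x" if x: "x \<in> X" for x
  proof -
    interpret U': subgroup "rootgrp M' (\<beta> x)" "BijGroup Y"
      using root'[OF x] by (simp add: is_root_group_def)
    have mem: "u \<in> rootgrp M x \<longleftrightarrow> T u \<in> rootgrp M' (\<beta> x)" if "u \<in> Bij X" for u
      using inj_on_image_mem_iff[OF T_inj that subX[OF x]] image_root[OF x] by simp
    have carr: "u \<in> Bij X" if "u \<in> rootgrp M x" for u
      using subX[OF x] that by auto
    have "subgroup (rootgrp M x) (BijGroup X)"
    proof
      show "rootgrp M x \<subseteq> carrier (BijGroup X)"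
        using subX[OF x] by simp
      show "u \<otimes>\<^bsub>BijGroup X\<^esub> v \<in> rootgrp M x" if "u \<in> rootgrp M x" "v \<in> rootgrp M x" for u v
        using that[THEN carr] mem[OF carr[OF that(1)]] mem[OF carr[OF that(2)]] that X.m_closed[of u v]
        by (simp add: mem T_mult)
      show "\<one>\<^bsub>BijGroup X\<^esub> \<in> rootgrp M x"
        using X.one_closed by (simp add: mem)
      show "inv\<^bsub>BijGroup X\<^esub> u \<in> rootgrp M x" if "u \<in> rootgrp M x" for u
        using carr[OF that] mem[OF carr[OF that]] that X.inv_closed[of u] T.hom_inv[of u]
        by (simp add: mem)
    qed
    moreover have "u x = x" if "u \<in> rootgrp M x" for u
    proof -
      have "T u (\<beta> x) = \<beta> x"
        using root'[OF x] that mem[OF carr[OF that]] by (simp add: is_root_group_def)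
      then show ?thesis
        using x carr[OF that] by (simp add: T_apply \<beta>_inj Bij_apply)
    qed
    moreover have "\<exists>!u. u \<in> rootgrp M x \<and> u y = y'"
      if y: "y \<in> X - {x}" "y' \<in> X - {x}" for y y'
    proof -
      have "\<beta> y \<in> Y - {\<beta> x}" "\<beta> y' \<in> Y - {\<beta> x}"
        using y x \<beta>_in \<beta>_inj by auto
      then have ex1: "\<exists>!w. w \<in> T ` rootgrp M x \<and> w (\<beta> y) = \<beta> y'"
        using root'[OF x] unfolding image_root[OF x] is_root_group_def by blast
      have iff: "T u (\<beta> y) = \<beta> y' \<longleftrightarrow> u y = y'" if "u \<in> rootgrp M x" for u
        using y carr[OF that] by (simp add: T_apply \<beta>_inj Bij_apply)
      have "inj_on T (rootgrp M x)"
        using T_inj subX[OF x] by (rule inj_on_subset)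
      then show ?thesis
        using ex1 iff by (smt (verit, best) imageE imageI inj_on_def)
    qed
    ultimately show ?thesis
      by (simp add: is_root_group_def)
  qed
  moreover have "rootgrp M y \<subseteq> root_automorphisms M" if y: "y \<in> X" for y
  proof
    fix \<phi> assume \<phi>: "\<phi> \<in> rootgrp M y"
    then have \<phi>B: "\<phi> \<in> Bij X"
      using subX y by auto
    have T\<phi>: "T \<phi> \<in> root_automorphisms M'"
      using root'(2)[OF y] image_root[OF y] \<phi> by auto
    have "conj_set X (rootgrp M x) \<phi> = rootgrp M (\<phi> x)" if x: "x \<in> X" for x
    proof -
      have "T ` conj_set X (rootgrp M x) \<phi> = conj_set Y (rootgrp M' (\<beta> x)) (T \<phi>)"
        using x \<phi>B subX by (simp add: T_image_conj image_root)
      also have "\<dots> = rootgrp M' (T \<phi> (\<beta> x))"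
        using T\<phi> \<beta>_in[OF x] by (simp add: root_automorphisms_def Y_def)
      also have "\<dots> = T ` rootgrp M (\<phi> x)"
        using x \<phi>B by (simp add: T_apply image_root Bij_apply)
      finally show ?thesis
        using inj_on_image_eq_iff[OF T_inj conj_set_subset[OF subX[OF x] \<phi>B] subX[OF Bij_apply[OF \<phi>B x]]]
        by simp
    qed
    then show "\<phi> \<in> root_automorphisms M"
      using \<phi>B by (simp add: root_automorphisms_def X_def)
  qed
  ultimately have "moufang_set M"
    by (simp add: moufang_set_iff X_def)
  then show ?thesis
    using M' \<beta> root by (auto simp: moufang_isomorphic_def)
qed

subsection \<open>The construction from a group and an involution\<close>

lemma mu_points_iff [simp]: "None \<in> mu_points G" "Some a \<in> mu_points G \<longleftrightarrow> a \<in> carrier G"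
  by (auto simp: mu_points_def)

lemma mu_points_cases:
  assumes "x \<in> mu_points G"
  obtains "x = None" | a where "x = Some a" "a \<in> carrier G"
  using assms by (auto simp: mu_points_def)

locale involutive_mu = group G for G :: "('a, 'b) monoid_scheme" (structure) +
  fixes \<tau> :: "'a \<Rightarrow> 'a"
  assumes tau_closed: "x \<in> carrier G \<Longrightarrow> x \<noteq> \<one> \<Longrightarrow> \<tau> x \<in> carrier G"
    and tau_neq_one: "x \<in> carrier G \<Longrightarrow> x \<noteq> \<one> \<Longrightarrow> \<tau> x \<noteq> \<one>"
    and tau_tau: "x \<in> carrier G \<Longrightarrow> x \<noteq> \<one> \<Longrightarrow> \<tau> (\<tau> x) = x"
begin

abbreviation "X \<equiv> mu_points G"
abbreviation "\<alpha> \<equiv> mu_alpha G"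
abbreviation "t \<equiv> mu_tau G \<tau>"
abbreviation comp (infixl "\<bullet>" 70) where "f \<bullet> g \<equiv> f \<otimes>\<^bsub>BijGroup X\<^esub> g"

lemma alpha_apply [simp]: "\<alpha> a None = None" "b \<in> carrier G \<Longrightarrow> \<alpha> a (Some b) = Some (b \<otimes> a)"
  by (simp_all add: mu_alpha_def)

lemma t_apply [simp]: "t None = Some \<one>" "t (Some \<one>) = None"
    "b \<in> carrier G \<Longrightarrow> b \<noteq> \<one> \<Longrightarrow> t (Some b) = Some (\<tau> b)"
  by (simp_all add: mu_tau_def)

lemma alpha_Bij [simp]:
  assumes a: "a \<in> carrier G"
  shows "\<alpha> a \<in> Bij X"
proof -
  have "bij_betw (\<alpha> a) X X"
    by (rule bij_betw_byWitness[where f' = "\<alpha> (inv a)"])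
      (auto elim!: mu_points_cases simp: a m_assoc)
  then show ?thesis
    by (simp add: Bij_def mu_alpha_def)
qed

lemma
  assumes "x \<in> X"
  shows t_in_X: "t x \<in> X" and t_t: "t (t x) = x"
proof -
  consider "x = None" | "x = Some \<one>" | b where "x = Some b" "b \<in> carrier G" "b \<noteq> \<one>"
    using assms by (auto elim!: mu_points_cases)
  then have "t x \<in> X \<and> t (t x) = x"
    by cases (simp_all add: tau_closed tau_neq_one tau_tau)
  then show "t x \<in> X" "t (t x) = x"
    by auto
qed

lemma t_Bij [simp]: "t \<in> Bij X"
proof -
  have "bij_betw t X X"
    by (rule bij_betw_byWitness[where f' = t]) (auto simp: t_in_X t_t)
  then show ?thesis
    by (simp add: Bij_def mu_tau_def)
qed

sublocale Bij: group "BijGroup X"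
  by (rule group_BijGroup)

lemma comp_Bij [simp]: "f \<in> Bij X \<Longrightarrow> g \<in> Bij X \<Longrightarrow> f \<bullet> g \<in> Bij X"
  using Bij.m_closed[of f g] by simp

lemma comp_assoc: "f \<in> Bij X \<Longrightarrow> g \<in> Bij X \<Longrightarrow> h \<in> Bij X \<Longrightarrow> f \<bullet> g \<bullet> h = f \<bullet> (g \<bullet> h)"
  using Bij.m_assoc[of f g h] by simp

lemma alpha_comp: "a \<in> carrier G \<Longrightarrow> b \<in> carrier G \<Longrightarrow> \<alpha> a \<bullet> \<alpha> b = \<alpha> (b \<otimes> a)"
  by (rule Bij_eqI[of _ X]) (auto simp: BijGroup_mult_apply m_assoc elim!: mu_points_cases)

lemma alpha_one: "\<alpha> \<one> = \<one>\<^bsub>BijGroup X\<^esub>"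
  using Bij.one_closed
  by (intro Bij_eqI[of _ X]) (auto simp: BijGroup_one_apply elim!: mu_points_cases)

lemma t_comp_t: "t \<bullet> t = \<one>\<^bsub>BijGroup X\<^esub>"
  using Bij.one_closed
  by (intro Bij_eqI[of _ X]) (auto simp: BijGroup_mult_apply BijGroup_one_apply t_t)

abbreviation "Uinf \<equiv> \<alpha> ` carrier G"

lemma Uinf_subset: "Uinf \<subseteq> Bij X"
  by auto

lemma subgroup_Uinf: "subgroup Uinf (BijGroup X)"
proof
  show "Uinf \<subseteq> carrier (BijGroup X)"
    using Uinf_subset by simp
  show "f \<bullet> g \<in> Uinf" if "f \<in> Uinf" "g \<in> Uinf" for f g
    using that by (auto simp: alpha_comp)
  show "\<one>\<^bsub>BijGroup X\<^esub> \<in> Uinf"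
    by (auto simp: alpha_one[symmetric])
  show "inv\<^bsub>BijGroup X\<^esub> f \<in> Uinf" if "f \<in> Uinf" for f
  proof -
    from that obtain a where a: "a \<in> carrier G" "f = \<alpha> a"
      by blast
    then have "inv\<^bsub>BijGroup X\<^esub> f = \<alpha> (inv a)"
      by (intro Bij.inv_equality) (auto simp: alpha_comp alpha_one)
    then show ?thesis
      using a by blast
  qed
qed

lemma is_root_group_Uinf: "is_root_group X Uinf None"
proof -
  have "\<exists>!u. u \<in> Uinf \<and> u y = y'" if y: "y \<in> X - {None}" "y' \<in> X - {None}" for y y'
  proof -
    from y obtain b b' where b: "y = Some b" "y' = Some b'" "b \<in> carrier G" "b' \<in> carrier G"
      by (auto simp: mu_points_def)
    show ?thesis
    proof (rule ex1I[of _ "\<alpha> (inv b \<otimes> b')"])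
      show "\<alpha> (inv b \<otimes> b') \<in> Uinf \<and> \<alpha> (inv b \<otimes> b') y = y'"
        using b by (simp add: m_assoc[symmetric])
      fix u assume "u \<in> Uinf \<and> u y = y'"
      then obtain a where "a \<in> carrier G" "u = \<alpha> a" "b \<otimes> a = b'"
        using b by auto
      then show "u = \<alpha> (inv b \<otimes> b')"
        using b by (auto simp: m_assoc[symmetric])
    qed
  qed
  then show ?thesis
    using subgroup_Uinf by (auto simp: is_root_group_def)
qed

text \<open>The permutation carrying \<open>\<infinity>\<close> to \<open>x\<close> that the construction uses to define \<open>U\<^sub>x\<close>.\<close>

definition carry :: "'a option \<Rightarrow> 'a option \<Rightarrow> 'a option" where
  "carry x = (case x of None \<Rightarrow> \<one>\<^bsub>BijGroup X\<^esub> | Some a \<Rightarrow> \<alpha> a \<bullet> t)"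

lemma carry_Bij: "x \<in> X \<Longrightarrow> carry x \<in> Bij X"
  using Bij.one_closed by (auto simp: carry_def elim!: mu_points_cases)

lemma carry_None: "x \<in> X \<Longrightarrow> carry x None = x"
  by (auto simp: carry_def BijGroup_one_apply BijGroup_mult_apply elim!: mu_points_cases)

lemma points_mu_set [simp]: "points (mu_set G \<tau>) = X"
  by (simp add: mu_set_def Let_def)

lemma rootgrp_mu_set:
  assumes "x \<in> X"
  shows "rootgrp (mu_set G \<tau>) x = conj_set X Uinf (carry x)"
  using assms Uinf_subset
  by (auto simp: mu_set_def Let_def carry_def conj_set_one conj_set_mult elim!: mu_points_cases)

text \<open>The Hua map of \<open>a\<close>. It fixes \<open>\<infinity>\<close>, and it measures the failure of \<open>\<tau>\<close> to carry
  \<open>U\<^sub>a\<close> to \<open>U\<^bsub>\<tau> a\<^esub>\<close>: the two groups agree exactly when it normalizes \<open>U\<^sub>\<infinity>\<close>.\<close>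

definition hua :: "'a \<Rightarrow> 'a option \<Rightarrow> 'a option" where
  "hua a = t \<bullet> \<alpha> (inv (\<tau> a)) \<bullet> t \<bullet> \<alpha> a \<bullet> t"

lemma hua_Bij: "a \<in> carrier G \<Longrightarrow> a \<noteq> \<one> \<Longrightarrow> hua a \<in> Bij X"
  by (simp add: hua_def tau_closed)

lemma hua_apply:
  "a \<in> carrier G \<Longrightarrow> a \<noteq> \<one> \<Longrightarrow> x \<in> X \<Longrightarrow> hua a x = t (\<alpha> (inv (\<tau> a)) (t (\<alpha> a (t x))))"
  by (simp add: hua_def tau_closed BijGroup_mult_apply Bij_apply)

lemma t_alpha_t:
  assumes "a \<in> carrier G" "a \<noteq> \<one>"
  shows "t \<bullet> (\<alpha> a \<bullet> t) = (\<alpha> (\<tau> a) \<bullet> t) \<bullet> hua a"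
proof (rule Bij_eqI[of _ X])
  have \<tau>: "\<tau> a \<in> carrier G"
    using assms by (rule tau_closed)
  show "t \<bullet> (\<alpha> a \<bullet> t) \<in> Bij X" "(\<alpha> (\<tau> a) \<bullet> t) \<bullet> hua a \<in> Bij X"
    using assms \<tau> by (simp_all add: hua_Bij)
  fix x assume x: "x \<in> X"
  have undo: "\<alpha> (\<tau> a) (\<alpha> (inv (\<tau> a)) y) = y" if "y \<in> X" for y
    using that \<tau> by (auto simp: m_assoc elim!: mu_points_cases)
  have "\<alpha> (\<tau> a) (t (hua a x)) = t (\<alpha> a (t x))"
    using assms x \<tau> by (simp add: hua_apply t_t undo Bij_apply)
  then show "(t \<bullet> (\<alpha> a \<bullet> t)) x = ((\<alpha> (\<tau> a) \<bullet> t) \<bullet> hua a) x"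
    using assms x \<tau> by (simp add: BijGroup_mult_apply hua_Bij Bij_apply)
qed

text \<open>If all Hua maps normalize \<open>U\<^sub>\<infinity>\<close>, then \<open>\<tau>\<close> permutes the root groups; as the
  translations do so in any case and all root groups are conjugates of \<open>U\<^sub>\<infinity>\<close> by products
  of these maps, they permute each other.\<close>

lemma moufang_set_mu_set:
  assumes hua: "\<And>a. a \<in> carrier G \<Longrightarrow> a \<noteq> \<one> \<Longrightarrow> conj_set X Uinf (hua a) = Uinf"
  shows "moufang_set (mu_set G \<tau>)"
proof -
  let ?M = "mu_set G \<tau>"
  have root: "is_root_group X (rootgrp ?M x) x" if "x \<in> X" for x
    using is_root_group_conj[OF is_root_group_Uinf carry_Bij[OF that]] that
    by (simp add: rootgrp_mu_set carry_None)
  have subgroup: "subgroup (root_automorphisms ?M) (BijGroup X)"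
    using subgroup_root_automorphisms[of ?M] is_root_group_subset[OF root] by simp
  then interpret Aut: subgroup "root_automorphisms ?M" "BijGroup X" .
  have alpha: "\<alpha> a \<in> root_automorphisms ?M" if a: "a \<in> carrier G" for a
  proof -
    have "conj_set X (conj_set X Uinf (carry x)) (\<alpha> a) = conj_set X Uinf (carry (\<alpha> a x))"
      if "x \<in> X" for x
    proof (cases x)
      case None
      then show ?thesis
        using a subgroup_Uinf Uinf_subset by (simp add: carry_def conj_set_one conj_set_self)
    next
      case (Some b)
      then have "\<alpha> a \<bullet> carry x = carry (\<alpha> a x)"
        using that a by (simp add: carry_def comp_assoc[symmetric] alpha_comp)
      then show ?thesis
        using Uinf_subset that a carry_Bij by (simp add: conj_set_mult)
    qed
    then show ?thesis
      using a by (simp add: root_automorphisms_def rootgrp_mu_set Bij_apply)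
  qed
  have "conj_set X (conj_set X Uinf (carry x)) t = conj_set X Uinf (carry (t x))"
    if "x \<in> X" for x
    using that
  proof (cases x rule: mu_points_cases)
    case 1
    then show ?thesis
      using Uinf_subset Bij.l_one[of t] by (simp add: carry_def conj_set_one alpha_one)
  next
    case (2 a)
    show ?thesis
    proof (cases "a = \<one>")
      case True
      then show ?thesis
        using 2 Uinf_subset Bij.l_one[of t] by (simp add: carry_def conj_set_mult alpha_one t_comp_t)
    next
      case False
      have "conj_set X Uinf (t \<bullet> carry x) = conj_set X (conj_set X Uinf (hua a)) (carry (t x))"
        using 2 False t_alpha_t[of a] Uinf_subset
        by (simp add: carry_def conj_set_mult hua_Bij tau_closed)
      then show ?thesis
        using 2 False Uinf_subset carry_Bij[OF that] by (simp add: conj_set_mult hua)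
    qed
  qed
  then have t: "t \<in> root_automorphisms ?M"
    by (simp add: root_automorphisms_def rootgrp_mu_set Bij_apply)
  have carry: "carry x \<in> root_automorphisms ?M" if "x \<in> X" for x
    using that Aut.one_closed Aut.m_closed alpha t
    by (auto simp: carry_def elim!: mu_points_cases)
  have "rootgrp ?M x \<subseteq> root_automorphisms ?M" if "x \<in> X" for x
    using that alpha carry Aut.m_closed Aut.m_inv_closed
    by (auto simp: rootgrp_mu_set conj_set_def)
  then show ?thesis
    using root by (simp add: moufang_set_iff)
qed

end

lemma additive_group_simps [simp]:
  "carrier (additive_group V) = V" "mult (additive_group V) = (+)" "one (additive_group V) = 0"
  by (simp_all add: additive_group_def)

lemma (in vector_space) additive_group_subspace:
  assumes "subspace V"
  shows "group (additive_group V)"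
    and "x \<in> V \<Longrightarrow> inv\<^bsub>additive_group V\<^esub> x = - x"
proof -
  show "group (additive_group V)"
    by (rule groupI)
      (use assms in \<open>auto simp: subspace_add subspace_0 add.assoc intro: bexI[of _ "- x" for x] subspace_neg\<close>)
  then show "inv\<^bsub>additive_group V\<^esub> x = - x" if "x \<in> V"
    by (rule group.inv_equality) (use assms that in \<open>auto simp: subspace_neg\<close>)
qed

text \<open>Conjugation by \<open>g\<close> turns the translation by \<open>v\<close> into the one by \<open>Q v\<close>, and \<open>Q\<close> maps onto
  \<open>V\<close> because \<open>g\<close> permutes all of \<open>V\<close> and \<open>c\<close>, the image of 0, lies in \<open>V\<close>.\<close>

lemma conj_translations_affine:
  fixes V :: "'a::ab_group_add set" and Q :: "'a \<Rightarrow> 'a"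
  defines "G \<equiv> additive_group V"
  assumes G: "group G"
    and g: "g \<in> Bij (mu_points G)" "g None = None"
    and affine: "\<And>x. x \<in> V \<Longrightarrow> g (Some x) = Some (Q x + c)"
    and Q: "\<And>x y. Q (x + y) = Q x + Q y"
  shows "conj_set (mu_points G) (mu_alpha G ` V) g = mu_alpha G ` V"
proof -
  let ?X = "mu_points G"
  interpret group G by fact
  interpret Bij: group "BijGroup ?X" by (rule group_BijGroup)
  have add: "x + y \<in> V" if "x \<in> V" "y \<in> V" for x y
    using m_closed that by (simp add: G_def)
  have zero: "0 \<in> V"
    using one_closed by (simp add: G_def)
  have minus: "- x \<in> V" if "x \<in> V" for x
    using that inv_closed[of x] l_inv[of x] by (simp add: G_def eq_neg_iff_add_eq_0[symmetric])
  have Q0: "Q 0 = 0"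
    using Q[of 0 0] by simp
  have image: "g ` ?X = ?X"
    using g by (simp add: Bij_def bij_betw_def)
  have affine_V: "Q x + c \<in> V" if "x \<in> V" for x
    using Bij_apply[OF g(1), of "Some x"] affine[OF that] that by (simp add: G_def)
  have c: "c \<in> V"
    using affine_V[OF zero] Q0 by simp
  have QV: "Q x \<in> V" if "x \<in> V" for x
    using add[OF affine_V[OF that] minus[OF c]] by simp
  have Q_surj: "\<exists>v\<in>V. Q v = w" if "w \<in> V" for w
  proof -
    have "Some (w + c) \<in> g ` ?X"
      using that c add by (simp add: image) (simp add: G_def)
    then obtain y where y: "y \<in> ?X" "g y = Some (w + c)"
      by auto
    then obtain v where "y = Some v" "v \<in> V"
      using g(2) by (cases y) (auto simp: G_def)
    then show ?thesis
      using affine y by auto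
  qed
  have alpha: "mu_alpha G v \<in> Bij ?X" if "v \<in> V" for v
  proof -
    have "bij_betw (mu_alpha G v) ?X ?X"
      by (rule bij_betw_byWitness[where f' = "mu_alpha G (- v)"])
        (use that add add[OF _ minus] in \<open>auto simp: mu_points_def mu_alpha_def G_def\<close>)
    then show ?thesis
      by (simp add: Bij_def mu_alpha_def)
  qed
  have "g \<otimes>\<^bsub>BijGroup ?X\<^esub> mu_alpha G v \<otimes>\<^bsub>BijGroup ?X\<^esub> inv\<^bsub>BijGroup ?X\<^esub> g = mu_alpha G (Q v)"
    if v: "v \<in> V" for v
  proof -
    have "g \<otimes>\<^bsub>BijGroup ?X\<^esub> mu_alpha G v = mu_alpha G (Q v) \<otimes>\<^bsub>BijGroup ?X\<^esub> g"
    proof (rule Bij_eqI[of _ ?X])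
      show "g \<otimes>\<^bsub>BijGroup ?X\<^esub> mu_alpha G v \<in> Bij ?X" "mu_alpha G (Q v) \<otimes>\<^bsub>BijGroup ?X\<^esub> g \<in> Bij ?X"
        using Bij.m_closed[of g "mu_alpha G v"] Bij.m_closed[of "mu_alpha G (Q v)" g]
          g(1) v by (simp_all add: alpha QV)
      fix x assume x: "x \<in> ?X"
      have "g (mu_alpha G v x) = mu_alpha G (Q v) (g x)"
      proof (cases x)
        case None
        then show ?thesis
          using g(2) by (simp add: mu_alpha_def)
      next
        case (Some y)
        then have "y \<in> V"
          using x by (simp add: G_def)
        then show ?thesis
          using Some v add affine_V by (simp add: mu_alpha_def affine Q G_def algebra_simps)
      qed
      then show "(g \<otimes>\<^bsub>BijGroup ?X\<^esub> mu_alpha G v) x = (mu_alpha G (Q v) \<otimes>\<^bsub>BijGroup ?X\<^esub> g) x"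
        using x g v by (simp add: BijGroup_mult_apply alpha QV)
    qed
    moreover have "g \<in> carrier (BijGroup ?X)" "mu_alpha G (Q v) \<in> carrier (BijGroup ?X)"
      using g v by (simp_all add: alpha QV)
    ultimately show ?thesis
      by (simp only: Bij.m_assoc Bij.inv_closed Bij.r_inv Bij.r_one)
  qed
  then have "conj_set ?X (mu_alpha G ` V) g = mu_alpha G ` (Q ` V)"
    unfolding conj_set_def image_image by (intro image_cong refl)
  also have "Q ` V = V"
    using QV Q_surj by blast
  finally show ?thesis .
qed

section \<open>Moufang subsets of the projective Moufang set of the octonions\<close>

context octonion_algebra
begin

lemma oinv_minus: "oinv (- x) = - oinv x"
  by (simp add: oct_inv_def cj_hom)

text \<open>The Hua maps of inversion. Since \<open>oinv x\<close> is \<open>cj x\<close> divided by the norm, everything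
  happens in the span of \<open>x\<close>, \<open>a\<close> and their conjugates, and only the norm form enters; in an
  associative algebra the right-hand side is \<open>- (a + a x a)\<close>.\<close>

lemma hua_identity:
  assumes x: "x \<noteq> 0" and a: "a \<noteq> 0" and r: "oinv x + a \<noteq> 0"
  shows "oinv (oinv (oinv x + a) - oinv a) = N a \<odot> cj x - (1 + B x (cj a)) \<odot> a"
proof -
  define F where "F = B x (cj a)"
  define q where "q = 1 + F + N x * N a"
  \<comment> \<open>\<open>q\<close> is, up to the factor \<open>N x\<close>, the norm of \<open>oinv x + a\<close>; the outer inversion
      undoes the division by \<open>q\<close> because \<open>N w = N a * q\<close>.\<close>
  define w where "w = N a \<odot> x - (1 + F) \<odot> cj a"
  have nz: "N x \<noteq> 0" "N a \<noteq> 0"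
    using x a by auto
  have "B (oinv x) a = inverse (N x) * F"
    by (simp add: oct_inv_def polar_hom F_def polar_cj_right)
  then have Nr: "N (oinv x + a) = inverse (N x) * q"
    using nz by (simp add: polar_commute[of a "oinv x"] nrm_add nrm_oinv q_def field_simps)
  then have q: "q \<noteq> 0"
    using r by (metis mult_zero_right nrm_eq_zero)
  have "oinv (oinv x + a) = (inverse q * N x) \<odot> (inverse (N x) \<odot> x + cj a)"
    by (simp add: oct_inv_def[of A "oinv x + a"] Nr cj_hom) (simp add: oct_inv_def cj_hom)
  also have "\<dots> = inverse q \<odot> x + (inverse q * N x) \<odot> cj a"
    using nz by (simp add: scale_right_distrib)
  finally have "oinv (oinv x + a) - oinv a
      = inverse q \<odot> x + (inverse q * N x - inverse (N a)) \<odot> cj a"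
    by (simp add: oct_inv_def[of A a] scale_left_diff_distrib)
  also have "inverse q * N x - inverse (N a) = - inverse (q * N a) * (1 + F)"
    using nz q by (simp add: field_simps) (simp add: q_def algebra_simps)
  also have "inverse q = inverse (q * N a) * N a"
    using nz by simp
  finally have s: "oinv (oinv x + a) - oinv a = inverse (q * N a) \<odot> w"
    by (simp add: w_def scale_right_diff_distrib)
  have "N w = N a * q"
    by (simp add: w_def nrm_diff nrm_scale polar_hom flip: F_def)
      (simp add: q_def power2_eq_square algebra_simps)
  then have "N (inverse (q * N a) \<odot> w) = inverse (q * N a)"
    using nz q by (simp add: nrm_scale power2_eq_square field_simps)
  then have "oinv (inverse (q * N a) \<odot> w) = cj w"
    using nz q by (simp add: oct_inv_def cj_hom field_simps)
  then show ?thesis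
    by (simp add: s w_def cj_hom F_def)
qed

lemma oinv_in_subspace:
  assumes "subspace V" "\<e> \<in> V" "x \<in> V"
  shows "oinv x \<in> V"
  using assms by (simp add: oct_inv_def oct_conj_def subspace_scale subspace_diff)

text \<open>By the identity above, the Hua map of \<open>a\<close> is the additive map \<open>x \<mapsto> N a cj x - B x (cj a) a\<close>
  followed by the translation by \<open>- a\<close>, so it normalizes the translations. The points \<open>0\<close> and
  \<open>- oinv a\<close>, where one of the inversions passes through \<open>\<infinity>\<close>, are treated separately.\<close>

lemma moufang_set_subspace:
  assumes V: "subspace V" and one: "\<e> \<in> V"
  shows "moufang_set (mu_set (additive_group V) oinv)"
proof -
  let ?G = "additive_group V"
  interpret group ?G
    using V by (rule additive_group_subspace)
  interpret involutive_mu ?G oinv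
    by unfold_locales (use V one oinv_in_subspace in auto)
  have t_zero: "t (Some 0) = None"
    using V by (simp add: mu_tau_def subspace_0)
  have "conj_set X Uinf (hua a) = Uinf" if "a \<in> carrier ?G" "a \<noteq> \<one>\<^bsub>?G\<^esub>" for a
  proof -
    have a: "a \<in> V" "a \<noteq> 0"
      using that by auto
    have inv_a: "oinv a \<in> V" "oinv a \<noteq> 0"
      using a V one oinv_in_subspace by auto
    define Q where "Q x = N a \<odot> cj x - B x (cj a) \<odot> a" for x
    have G: "group ?G" ..
    have "hua a \<in> Bij X"
      using that by (rule hua_Bij)
    moreover have "hua a None = None"
      using a inv_a V t_zero by (simp add: hua_apply additive_group_subspace subspace_0)
    moreover have "hua a (Some x) = Some (Q x + - a)" if x: "x \<in> V" for x
    proof -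
      consider "x = 0" | "x \<noteq> 0" "oinv x + a = 0" | "x \<noteq> 0" "oinv x + a \<noteq> 0"
        by blast
      then show ?thesis
      proof cases
        case 1
        then show ?thesis
          using a inv_a V t_zero
          by (simp add: hua_apply additive_group_subspace subspace_0 subspace_neg oinv_minus Q_def)
      next
        case 2
        then have "x = - oinv a"
          by (metis add_eq_0_iff2 oinv_minus oinv_oinv)
        then have "Q x = 2 \<odot> a - a"
          using a by (simp add: Q_def cj_hom oct_inv_def polar_hom polar_self)
        also have "\<dots> = a"
          using scale_left_distrib[of 1 1 a] by simp
        finally have "Q x = a" .
        then show ?thesis
          using 2 x a inv_a V one t_zero
          by (simp add: hua_apply additive_group_subspace subspace_0 oinv_in_subspace)
      next
        case 3
        have "oinv (oinv x + a) \<noteq> oinv a"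
          using 3 by (metis add_cancel_left_left oinv_eq_zero oinv_oinv)
        moreover have "oinv x + a \<in> V"
          using V one x a by (simp add: oinv_in_subspace subspace_add)
        ultimately show ?thesis
          using 3 x a inv_a V one hua_identity[of x a]
          by (simp add: hua_apply additive_group_subspace oinv_in_subspace subspace_add
              subspace_diff Q_def scale_left_distrib)
      qed
    qed
    moreover have "Q (x + y) = Q x + Q y" for x y
      by (simp add: Q_def cj_hom polar_hom algebra_simps scale_right_distrib scale_left_distrib)
    ultimately show ?thesis
      using conj_translations_affine[OF G, of "hua a" Q "- a"] by simp
  qed
  then show ?thesis
    by (rule moufang_set_mu_set)
qed

end

section \<open>The anti-automorphism behind a polarity of type IV\<close>

locale type_IV_octonion = octonion_algebra +
  fixes D :: "'b set" and z :: 'b and \<eta> :: "'b \<Rightarrow> 'b"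
  assumes char_two: "CHAR('a) = 2"
    and type_IV: "type_IV_automorphism A D z \<eta>"
begin

lemma one_add_one: "(1::'a) + 1 = 0"
  using of_nat_CHAR[where 'a = 'a] char_two by simp

lemma scalar_char_two [simp]: "(c::'a) + c = 0" "c + (c + c') = c'" "- c = c" "c - c' = c + c'"
proof -
  have self: "c + c = 0" for c :: 'a
    using one_add_one by (metis distrib_left mult.right_neutral mult_zero_right)
  then show "c + c = 0" "c + (c + c') = c'" "- c = c"
    by (simp_all add: add.assoc[symmetric] eq_neg_iff_add_eq_0[symmetric] neg_eq_iff_add_eq_0)
  then show "c - c' = c + c'"
    using self by (metis diff_conv_add_uminus neg_eq_iff_add_eq_0)
qed

lemma vector_char_two [simp]: "(x::'b) + x = 0" "x + (x + y) = y" "- x = x" "x - y = x + y"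
proof -
  have self: "x + x = 0" for x :: 'b
    using scale_left_distrib[of 1 1 x] one_add_one by simp
  then show "x + x = 0" "x + (x + y) = y" "- x = x"
    by (simp_all add: add.assoc[symmetric] eq_neg_iff_add_eq_0[symmetric] neg_eq_iff_add_eq_0)
  then show "x - y = x + y"
    using self by (metis diff_conv_add_uminus neg_eq_iff_add_eq_0)
qed

lemma char_two_move: "(x::'b) + y = w \<Longrightarrow> x = y + w"
  by (auto simp: ac_simps)

lemma D_subspace: "subspace D" and dim_D: "dim D = 4" and one_D: "\<e> \<in> D"
  and D_mul: "x \<in> D \<Longrightarrow> y \<in> D \<Longrightarrow> x \<cdot> y \<in> D"
  and D_polar: "x \<in> D \<Longrightarrow> y \<in> D \<Longrightarrow> B x y = 0"
  and z_notin_D: "z \<notin> D" and trace_z: "z + cj z = \<e>"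
  and eta_def: "d \<in> D \<Longrightarrow> d' \<in> D \<Longrightarrow> \<eta> (d + d' \<cdot> z) = d + d' \<cdot> cj z"
  using type_IV by (auto simp: type_IV_automorphism_def oct_trace_def)

lemmas D_closed = D_mul subspace_add[OF D_subspace] subspace_scale[OF D_subspace]
  subspace_0[OF D_subspace] one_D

lemma cj_z: "cj z = z + \<e>"
  using trace_z vector_char_two(2) by metis

lemma polar_z_one: "B \<e> z = 1" "B z \<e> = 1"
proof -
  have "B z \<e> \<odot> \<e> = 1 \<odot> \<e>"
    using trace_z by (simp add: oct_conj_def ac_simps)
  then show "B z \<e> = 1"
    using one_nonzero scale_right_imp_eq by blast
  then show "B \<e> z = 1"
    by (simp add: polar_commute)
qed

lemma cj_D: "d \<in> D \<Longrightarrow> cj d = d"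
  by (simp add: oct_conj_def D_polar one_D)

lemma D_square: "d \<in> D \<Longrightarrow> d \<cdot> (d \<cdot> w) = N d \<odot> w"
  using cj_mul_cancel_left(1)[of d w] by (simp add: cj_D)

subsection \<open>The decomposition along the totally singular subfield\<close>

lemma unique_D_decomposition:
  assumes "d \<in> D" "d' \<in> D" "d + d' \<cdot> z = 0"
  shows "d = 0" "d' = 0"
proof -
  show "d' = 0"
  proof (rule ccontr)
    assume d': "d' \<noteq> 0"
    have "d' \<cdot> z = d"
      using assms(3) vector_char_two(2)[of d "d' \<cdot> z"] by simp
    then have "N d' \<odot> z = d' \<cdot> d"
      using D_square[OF assms(2), of z] by simp
    then have "N d' \<odot> z \<in> D"
      using assms by (simp add: D_closed)
    then have "inverse (N d') \<odot> (N d' \<odot> z) \<in> D"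
      by (rule subspace_scale[OF D_subspace])
    then show False
      using d' z_notin_D by simp
  qed
  then show "d = 0"
    using assms by simp
qed

text \<open>The dimension is a cardinality, and infinite sets have cardinality 0, so dimension 8 provides
  a finite basis.\<close>

lemma finite_basis: obtains Bas where "finite_dimensional_vector_space (scl A) Bas"
proof -
  obtain Bas where "independent Bas" "UNIV \<subseteq> span Bas" "card Bas = dim UNIV"
    using basis_exists by blast
  moreover from this have "finite Bas"
    using dim_UNIV_eq card_ge_0_finite by force
  ultimately show thesis
    by (intro that, unfold_locales) auto
qed

text \<open>The subspaces \<open>D\<close> and \<open>D z\<close> are 4-dimensional and meet in 0.\<close>

lemma D_decomposition:
  obtains d d' where "d \<in> D" "d' \<in> D" "x = d + d' \<cdot> z"
proof -
  obtain Bas where "finite_dimensional_vector_space (scl A) Bas"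
    by (rule finite_basis)
  then interpret fd: finite_dimensional_vector_space "scl A" Bas .
  interpret right: Vector_Spaces.linear "scl A" "scl A" "\<lambda>d. d \<cdot> z"
    using octonion by (simp add: octonion_division_algebra_def)
  let ?Dz = "(\<lambda>d. d \<cdot> z) ` D"
  let ?S = "{x + y |x y. x \<in> D \<and> y \<in> ?Dz}"
  have z0: "z \<noteq> 0"
    using z_notin_D D_closed by auto
  have inj: "inj_on (\<lambda>d. d \<cdot> z) U" for U
  proof (rule inj_onI)
    fix a b assume "a \<cdot> z = b \<cdot> z"
    then have "(a - b) \<cdot> z = 0"
      by (simp only: mul_hom) simp
    then show "a = b"
      using z0 vector_char_two(2)[of b a] by (auto simp: add.commute)
  qed
  have subspace_Dz: "subspace ?Dz"
    using D_subspace by (rule right.subspace_image)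
  obtain C where C: "C \<subseteq> D" "independent C" "D \<subseteq> span C" "card C = dim D"
    by (rule basis_exists)
  have "dim ?Dz = 4"
  proof (rule dim_unique)
    show "(\<lambda>d. d \<cdot> z) ` C \<subseteq> ?Dz" "independent ((\<lambda>d. d \<cdot> z) ` C)"
      using C inj right.independent_injective_image by auto
    show "?Dz \<subseteq> span ((\<lambda>d. d \<cdot> z) ` C)"
      using C by (auto simp: right.span_image)
    show "card ((\<lambda>d. d \<cdot> z) ` C) = 4"
      using C inj dim_D by (simp add: card_image)
  qed
  moreover have "D \<inter> ?Dz = {0}"
  proof
    show "D \<inter> ?Dz \<subseteq> {0}"
      using unique_D_decomposition by fastforce
    show "{0} \<subseteq> D \<inter> ?Dz"
      using subspace_0[OF subspace_Dz] D_closed by simp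
  qed
  ultimately have "dim ?S = 8"
    using fd.dim_sums_Int[OF D_subspace subspace_Dz] dim_D by simp
  then have "?S = UNIV"
    using subspace_sums[OF D_subspace subspace_Dz] dim_UNIV_eq
    by (intro fd.subspace_dim_equal) auto
  then show thesis
    using that by blast
qed

lemma eta_decomposition:
  "d \<in> D \<Longrightarrow> d' \<in> D \<Longrightarrow> \<eta> (d + d' \<cdot> z) = (d + d') + d' \<cdot> z"
  by (simp add: eta_def cj_z mul_hom ac_simps)

text \<open>The next lemmas express all products of elements of \<open>D\<close> and \<open>D z\<close> in the form
  \<open>d + d' z\<close>. They use the linearized alternative laws to move \<open>z\<close> to the right; elements of
  \<open>D\<close> are their own conjugates, and \<open>cj z = z + 1\<close>.\<close>

lemma z_mul_D:
  assumes "d \<in> D"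
  shows "z \<cdot> d = d \<cdot> z + d + B d z \<odot> \<e>"
proof -
  have "z \<cdot> d + (d \<cdot> z + d) = B d z \<odot> \<e>"
    using right_alternative_linearized[of \<e> d z] assms
    by (simp add: cj_D cj_z mul_hom ac_simps)
  then show ?thesis
    by (rule char_two_move)
qed

lemma mul_z_mul_D:
  assumes "a \<in> D" "b \<in> D"
  shows "(a \<cdot> z) \<cdot> b = (a \<cdot> b + B b z \<odot> a) + (a \<cdot> b) \<cdot> z"
proof -
  have "(a \<cdot> z) \<cdot> b + (a \<cdot> b + (a \<cdot> b) \<cdot> z) = B b z \<odot> a"
    using right_alternative_linearized[of a z b] assms
    by (simp add: cj_D cj_z mul_hom polar_commute[of z] ac_simps)
  then have "(a \<cdot> z) \<cdot> b = (a \<cdot> b + (a \<cdot> b) \<cdot> z) + B b z \<odot> a"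
    by (rule char_two_move)
  then show ?thesis
    by (simp add: ac_simps)
qed

lemma D_mul_mul_z:
  assumes "a \<in> D" "b \<in> D"
  shows "a \<cdot> (b \<cdot> z)
    = (a \<cdot> b + B (a \<cdot> b) z \<odot> \<e> + B a z \<odot> b + B b z \<odot> a) + (a \<cdot> b) \<cdot> z"
proof -
  have "a \<cdot> (z \<cdot> b) + (a \<cdot> b + z \<cdot> (a \<cdot> b)) = B a z \<odot> b"
    using left_alternative_linearized[of a z b] assms
    by (simp add: cj_D cj_z mul_hom ac_simps)
  moreover have "a \<cdot> (z \<cdot> b) = a \<cdot> (b \<cdot> z) + (a \<cdot> b + B b z \<odot> a)"
    using assms by (simp add: z_mul_D mul_hom ac_simps)
  ultimately have "a \<cdot> (b \<cdot> z) + (B b z \<odot> a + z \<cdot> (a \<cdot> b)) = B a z \<odot> b"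
    by (simp add: ac_simps)
  then have "a \<cdot> (b \<cdot> z) = B b z \<odot> a + z \<cdot> (a \<cdot> b) + B a z \<odot> b"
    by (rule char_two_move)
  then show ?thesis
    using assms by (simp add: z_mul_D D_mul ac_simps)
qed

lemma mul_z_mul_mul_z:
  assumes "a \<in> D" "b \<in> D"
  shows "(a \<cdot> z) \<cdot> (b \<cdot> z)
    = (N z \<odot> (a \<cdot> b) + a \<cdot> b + B (a \<cdot> b) z \<odot> \<e> + B a z \<odot> b + B b z \<odot> a)
      + (B (a \<cdot> b) z \<odot> \<e> + a \<cdot> b + B a z \<odot> b) \<cdot> z"
proof -
  have "a \<cdot> z = z \<cdot> a + a + B a z \<odot> \<e>"
    using z_mul_D[OF assms(1)] by (simp add: ac_simps)
  then have "(a \<cdot> z) \<cdot> (b \<cdot> z) = (z \<cdot> a) \<cdot> (b \<cdot> z) + a \<cdot> (b \<cdot> z) + B a z \<odot> (b \<cdot> z)"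
    by (simp add: mul_hom)
  also have "(z \<cdot> a) \<cdot> (b \<cdot> z) = B (a \<cdot> b) z \<odot> z + N z \<odot> (a \<cdot> b)"
    using assms by (simp add: middle_moufang cj_D D_mul polar_commute[of z])
  also have "a \<cdot> (b \<cdot> z)
    = (a \<cdot> b + B (a \<cdot> b) z \<odot> \<e> + B a z \<odot> b + B b z \<odot> a) + (a \<cdot> b) \<cdot> z"
    using assms by (rule D_mul_mul_z)
  finally show ?thesis
    by (simp add: mul_hom ac_simps)
qed

lemma mul_decomposition:
  assumes "a \<in> D" "b \<in> D" "c \<in> D" "d \<in> D"
  shows "(a + b \<cdot> z) \<cdot> (c + d \<cdot> z) =
    (a \<cdot> c + (a \<cdot> d + B (a \<cdot> d) z \<odot> \<e> + B a z \<odot> d + B d z \<odot> a) + (b \<cdot> c + B c z \<odot> b)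
      + (N z \<odot> (b \<cdot> d) + b \<cdot> d + B (b \<cdot> d) z \<odot> \<e> + B b z \<odot> d + B d z \<odot> b))
    + (a \<cdot> d + b \<cdot> c + B (b \<cdot> d) z \<odot> \<e> + b \<cdot> d + B b z \<odot> d) \<cdot> z"
proof -
  have "(a + b \<cdot> z) \<cdot> (c + d \<cdot> z) = a \<cdot> c + a \<cdot> (d \<cdot> z) + (b \<cdot> z) \<cdot> c + (b \<cdot> z) \<cdot> (d \<cdot> z)"
    by (simp add: mul_hom ac_simps)
  then show ?thesis
    using assms by (simp add: D_mul_mul_z mul_z_mul_D mul_z_mul_mul_z mul_hom ac_simps)
qed

text \<open>In coordinates \<open>\<eta>\<close> adds the \<open>z\<close>-coefficient to the \<open>D\<close>-part. So \<open>\<eta>\<close> is multiplicative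
  because, in the product formula above, replacing \<open>(a, c)\<close> by \<open>(a + b, c + d)\<close> leaves the
  \<open>z\<close>-coefficient unchanged and adds it to the \<open>D\<close>-part.\<close>

lemma eta_mul: "\<eta> (x \<cdot> y) = \<eta> x \<cdot> \<eta> y"
proof -
  obtain a b c d where D: "a \<in> D" "b \<in> D" "c \<in> D" "d \<in> D"
      and xy: "x = a + b \<cdot> z" "y = c + d \<cdot> z"
    by (metis D_decomposition)
  show ?thesis
    unfolding xy using D
    by (simp add: mul_decomposition eta_decomposition D_closed)
      (simp add: mul_hom polar_hom scale_left_distrib scale_right_distrib ac_simps)
qed

definition \<sigma> :: "'b \<Rightarrow> 'b" where "\<sigma> x = \<eta> (cj x)"

lemma sigma_decomposition:
  assumes "d \<in> D" "d' \<in> D"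
  shows "\<sigma> (d + d' \<cdot> z) = (d + d' + B d' z \<odot> \<e>) + d' \<cdot> z"
proof -
  have "cj (d + d' \<cdot> z) = (d + B d' z \<odot> \<e>) + d' \<cdot> z"
    using assms by (simp add: cj_hom cj_mul cj_z cj_D mul_hom z_mul_D ac_simps)
  then have "\<sigma> (d + d' \<cdot> z) = ((d + B d' z \<odot> \<e>) + d') + d' \<cdot> z"
    using assms unfolding \<sigma>_def by (simp only: eta_decomposition D_closed)
  then show ?thesis
    by (simp add: ac_simps)
qed

lemma sigma_mul: "\<sigma> (x \<cdot> y) = \<sigma> y \<cdot> \<sigma> x"
  by (simp add: \<sigma>_def cj_mul eta_mul)

lemma sigma_add: "\<sigma> (x + y) = \<sigma> x + \<sigma> y"
proof -
  obtain a b c d where D: "a \<in> D" "b \<in> D" "c \<in> D" "d \<in> D"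
      and xy: "x = a + b \<cdot> z" "y = c + d \<cdot> z"
    by (metis D_decomposition)
  have "x + y = (a + c) + (b + d) \<cdot> z"
    by (simp add: xy mul_hom ac_simps)
  then have "\<sigma> (x + y) = (a + c + (b + d) + B (b + d) z \<odot> \<e>) + (b + d) \<cdot> z"
    using D by (simp add: sigma_decomposition D_closed)
  then show ?thesis
    using D by (simp add: xy sigma_decomposition mul_hom polar_hom scale_left_distrib ac_simps)
qed

lemma sigma_sigma [simp]: "\<sigma> (\<sigma> x) = x"
proof -
  obtain a b where D: "a \<in> D" "b \<in> D" "x = a + b \<cdot> z"
    by (rule D_decomposition)
  then have "\<sigma> (\<sigma> x) = ((a + b + B b z \<odot> \<e>) + b + B b z \<odot> \<e>) + b \<cdot> z"
    by (simp only: sigma_decomposition D_closed)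
  then show ?thesis
    using D by (simp add: ac_simps)
qed

lemma sigma_zero [simp]: "\<sigma> 0 = 0"
  using sigma_add[of 0 0] by simp

lemma sigma_eq_zero [simp]: "\<sigma> x = 0 \<longleftrightarrow> x = 0"
  by (metis sigma_sigma sigma_zero)

lemma sigma_one: "\<sigma> \<e> = \<e>"
  using sigma_decomposition[of \<e> 0] D_closed by simp

lemma sigma_oinv: "\<sigma> (oinv x) = oinv (\<sigma> x)"
proof (cases "x = 0")
  case False
  have "oinv x \<cdot> x = \<e>"
    using oinv_cancel(4)[OF False, of \<e>] by simp
  then have "\<sigma> x \<cdot> \<sigma> (oinv x) = \<e>"
    by (simp add: sigma_one flip: sigma_mul)
  then show ?thesis
    using oinv_cancel(2)[of "\<sigma> x" "\<sigma> (oinv x)"] False by simp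
qed (simp add: oct_inv_def)

subsection \<open>The fixed space\<close>

definition Fix :: "'b set" where "Fix = {y. \<sigma> y = y}"

text \<open>Fixed vectors have a scalar \<open>z\<close>-coefficient, since \<open>B d' z\<close> recovers the scalar when
  \<open>d'\<close> is a multiple of the unit.\<close>

lemma Fix_decomposition:
  assumes "d \<in> D" "d' \<in> D"
  shows "d + d' \<cdot> z \<in> Fix \<longleftrightarrow> d' = B d' z \<odot> \<e>"
proof -
  have "\<sigma> (d + d' \<cdot> z) = (d' + B d' z \<odot> \<e>) + (d + d' \<cdot> z)"
    using assms by (simp add: sigma_decomposition ac_simps)
  then have "d + d' \<cdot> z \<in> Fix \<longleftrightarrow> d' + B d' z \<odot> \<e> = 0"
    by (simp add: Fix_def)
  then show ?thesis
    by (metis vector_char_two(1,4) eq_iff_diff_eq_0)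
qed

lemma Fix_eq: "Fix = {x + y |x y. x \<in> D \<and> y \<in> span {z}}"
proof (intro equalityI subsetI)
  fix x assume x: "x \<in> Fix"
  obtain d d' where D: "d \<in> D" "d' \<in> D" "x = d + d' \<cdot> z"
    by (rule D_decomposition)
  then have "d' = B d' z \<odot> \<e>"
    using Fix_decomposition x by simp
  then have "d' \<cdot> z = B d' z \<odot> z"
    by (metis mul_hom(7) mul_one(1))
  then show "x \<in> {x + y |x y. x \<in> D \<and> y \<in> span {z}}"
    using D by (auto simp: span_singleton)
next
  fix x assume "x \<in> {x + y |x y. x \<in> D \<and> y \<in> span {z}}"
  then obtain d c where d: "d \<in> D" "x = d + c \<odot> z"
    by (auto simp: span_singleton)
  then have "x = d + (c \<odot> \<e>) \<cdot> z"
    by (simp add: mul_hom)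
  then show "x \<in> Fix"
    using d Fix_decomposition[of d "c \<odot> \<e>"] by (simp add: D_closed polar_hom polar_z_one)
qed

lemma subspace_Fix: "subspace Fix"
  unfolding Fix_eq by (intro subspace_sums D_subspace subspace_span)

lemma dim_Fix: "dim Fix = 5"
proof -
  obtain Bas where "finite_dimensional_vector_space (scl A) Bas"
    by (rule finite_basis)
  then interpret fd: finite_dimensional_vector_space "scl A" Bas .
  have "c \<odot> z \<in> D \<Longrightarrow> c = 0" for c
    using unique_D_decomposition(2)[of "c \<odot> z" "c \<odot> \<e>"] one_nonzero
    by (simp add: D_closed mul_hom)
  then have "D \<inter> span {z} = {0}"
    using D_closed by (auto simp: span_singleton)
  moreover have "z \<noteq> 0"
    using z_notin_D D_closed by auto
  ultimately show ?thesis
    using fd.dim_sums_Int[OF D_subspace subspace_span[of "{z}"]] dim_D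
    by (simp add: Fix_eq)
qed

lemma one_Fix: "\<e> \<in> Fix"
  by (simp add: Fix_def sigma_one)

lemma add_sigma_eq:
  obtains d where "d \<in> D" "b + \<sigma> b = d" "B d z = 0"
proof -
  obtain d d' where D: "d \<in> D" "d' \<in> D" "b = d + d' \<cdot> z"
    by (rule D_decomposition)
  then have "b + \<sigma> b = d' + B d' z \<odot> \<e>"
    by (simp add: sigma_decomposition ac_simps)
  moreover have "B (d' + B d' z \<odot> \<e>) z = 0" "d' + B d' z \<odot> \<e> \<in> D"
    using D by (simp_all add: D_closed polar_hom polar_z_one)
  ultimately show thesis
    using that by blast
qed

text \<open>Writing \<open>a = d + d' z\<close>, the value \<open>\<sigma>(a) a\<close> has \<open>z\<close>-coefficient \<open>N d'\<close>, while \<open>b + \<sigma> b\<close>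
  lies in the part of \<open>D\<close> orthogonal to \<open>z\<close>. Comparing coefficients gives \<open>N d' = 0\<close>, so \<open>a = d\<close> and
  \<open>\<sigma>(a) a\<close> is the scalar \<open>N a\<close>, which is orthogonal to \<open>z\<close> only if it vanishes.\<close>

lemma hermitian_anisotropic:
  assumes "\<sigma> a \<cdot> a + b + \<sigma> b = 0"
  shows "a = 0"
proof -
  obtain d d' where D: "d \<in> D" "d' \<in> D" and a: "a = d + d' \<cdot> z"
    by (rule D_decomposition)
  obtain y where y: "y \<in> D" "b + \<sigma> b = y" "B y z = 0"
    by (rule add_sigma_eq)
  have \<sigma>a: "\<sigma> a = a + B d' z \<odot> \<e> + d'"
    using D by (simp add: a sigma_decomposition ac_simps)
  have "B a \<e> = B d' z"
    using D by (simp add: a polar_hom polar_adjoint_right D_polar one_D cj_z)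
  then have "a + B d' z \<odot> \<e> = cj a"
    by (simp add: oct_conj_def ac_simps)
  then have "\<sigma> a \<cdot> a = N a \<odot> \<e> + d' \<cdot> a"
    using cj_mul_cancel_left(1)[of a \<e>] by (simp add: \<sigma>a mul_hom)
  also have "\<dots> = N a \<odot> \<e> + d' \<cdot> d + N d' \<odot> z"
    using D by (simp add: a mul_hom D_square ac_simps)
  also have "\<sigma> a \<cdot> a = y"
    using assms y(2) vector_char_two(2)[of "\<sigma> a \<cdot> a" y] by (simp add: add.assoc)
  finally have eq: "y = N a \<odot> \<e> + d' \<cdot> d + N d' \<odot> z" .
  then have "(y + N a \<odot> \<e> + d' \<cdot> d) + (N d' \<odot> \<e>) \<cdot> z = 0"
    by (simp add: mul_hom ac_simps)
  then have "N d' \<odot> \<e> = 0"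
    using D y by (intro unique_D_decomposition(2)[of _ "N d' \<odot> \<e>"]) (auto simp: D_closed)
  then have d': "d' = 0"
    using one_nonzero by simp
  then have "B (N a \<odot> \<e>) z = 0"
    using eq y by simp
  then show "a = 0"
    by (simp add: polar_hom polar_z_one)
qed

end

section \<open>Collineations and flag root groups\<close>

type_synonym 'a plane_map = "('a point \<Rightarrow> 'a point) \<times> ('a line \<Rightarrow> 'a line)"

abbreviation "inv_map f \<equiv> inv_into UNIV f"

definition plane_conj :: "'a plane_map \<Rightarrow> 'a plane_map \<Rightarrow> 'a plane_map" where
  "plane_conj h g = (fst h \<circ> fst g \<circ> inv_map (fst h), snd h \<circ> snd g \<circ> inv_map (snd h))"

definition plane_inv :: "'a plane_map \<Rightarrow> 'a plane_map" where
  "plane_inv h = (inv_map (fst h), inv_map (snd h))"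

context octonion_algebra
begin

lemma collineationD:
  assumes "collineation A g"
  shows "bij (fst g)" "bij (snd g)" "incident A (fst g p) (snd g l) \<longleftrightarrow> incident A p l"
    "fst g p = fst g p' \<longleftrightarrow> p = p'" "snd g l = snd g l' \<longleftrightarrow> l = l'"
  using assms by (auto simp: collineation_def bij_def inj_eq)

lemma collineation_inv_apply:
  assumes "collineation A h"
  shows "inv_map (fst h) (fst h p) = p" "fst h (inv_map (fst h) p) = p"
    "inv_map (snd h) (snd h l) = l" "snd h (inv_map (snd h) l) = l"
  using collineationD(1,2)[OF assms]
  by (simp_all add: bij_is_inj bij_is_surj surj_f_inv_f)

lemma collineation_inv:
  assumes h: "collineation A h"
  shows "collineation A (plane_inv h)"
  using collineationD(1,2)[OF h] collineationD(3)[OF h, of "inv_map (fst h) p" "inv_map (snd h) l" for p l]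
  by (simp add: collineation_def plane_inv_def bij_imp_bij_inv collineation_inv_apply[OF h])

lemma collineation_comp:
  "collineation A g \<Longrightarrow> collineation A h \<Longrightarrow> collineation A (fst g \<circ> fst h, snd g \<circ> snd h)"
  by (simp add: collineation_def bij_comp)

lemma collineation_conj:
  assumes "collineation A h" "collineation A g"
  shows "collineation A (plane_conj h g)"
  using collineation_comp[OF collineation_comp[OF assms] collineation_inv[OF assms(1)]]
  by (simp add: plane_conj_def plane_inv_def)

lemma plane_root_group_conj:
  assumes h: "collineation A h" and g: "g \<in> plane_root_group A c l"
  shows "plane_conj h g \<in> plane_root_group A (fst h c) (snd h l)"
proof -
  have "incident A (inv_map (fst h) p) l" if "incident A p (snd h l)" for p
    using that collineationD(3)[OF h, of "inv_map (fst h) p" l] by (simp add: collineation_inv_apply[OF h])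
  moreover have "incident A c (inv_map (snd h) m)" if "incident A (fst h c) m" for m
    using that collineationD(3)[OF h, of c "inv_map (snd h) m"] by (simp add: collineation_inv_apply[OF h])
  moreover have "collineation A g"
    using g by (simp add: plane_root_group_def)
  ultimately show ?thesis
    using g collineation_conj[OF h]
    by (simp add: plane_root_group_def) (simp add: plane_conj_def collineation_inv_apply[OF h])
qed

lemma flag_root_product_conj:
  assumes h: "collineation A h" and g: "g \<in> flag_root_product A p l (q, m)"
  shows "plane_conj h g \<in> flag_root_product A (fst h p) (snd h l) (fst h q, snd h m)"
proof -
  obtain g1 g2 g3 where gs: "g1 \<in> plane_root_group A q l" "g2 \<in> plane_root_group A p l"
      "g3 \<in> plane_root_group A p m"
      and eq: "g = (fst g1 \<circ> fst g2 \<circ> fst g3, snd g1 \<circ> snd g2 \<circ> snd g3)"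
    using g by (auto simp: flag_root_product_def)
  have "plane_conj h g = (fst (plane_conj h g1) \<circ> fst (plane_conj h g2) \<circ> fst (plane_conj h g3),
      snd (plane_conj h g1) \<circ> snd (plane_conj h g2) \<circ> snd (plane_conj h g3))"
    by (simp add: eq plane_conj_def fun_eq_iff collineation_inv_apply[OF h])
  then show ?thesis
    using gs[THEN plane_root_group_conj[OF h]]
    unfolding flag_root_product_def fst_conv snd_conv mem_Collect_eq by blast
qed

lemma collineation_flag_root_product:
  assumes "g \<in> flag_root_product A p l qm"
  shows "collineation A g"
  using assms collineation_comp[OF collineation_comp]
  by (fastforce simp: flag_root_product_def plane_root_group_def)

lemma plane_root_group_subset_product:
  assumes "g \<in> plane_root_group A p l"
  shows "g \<in> flag_root_product A p l qm"
proof -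
  have "(id, id) \<in> plane_root_group A c m" for c m
    by (simp add: plane_root_group_def collineation_def)
  then show ?thesis
    using assms unfolding flag_root_product_def
    by (intro CollectI exI[of _ "(id, id)"] exI[of _ g]) auto
qed

lemma flag_root_product_fixes:
  assumes "g \<in> flag_root_product A p l (q, m)" "incident A p l" "incident A p m"
  shows "fst g p = p"
  using assms by (auto simp: flag_root_product_def plane_root_group_def)

lemma incident_Vert_iff: "incident A p (Vert a) \<longleftrightarrow> p = PInf \<or> (\<exists>b. p = Aff a b)"
  by (cases p) auto

lemma incident_LInf_iff: "incident A p LInf \<longleftrightarrow> p = PInf \<or> (\<exists>c. p = Slope c)"
  by (cases p) auto

lemma incident_PInf_iff: "incident A PInf l \<longleftrightarrow> l = LInf \<or> (\<exists>a. l = Vert a)"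
  by (cases l) auto

lemma incident_Slope_iff: "incident A (Slope c) l \<longleftrightarrow> l = LInf \<or> (\<exists>k. l = Graph c k)"
  by (cases l) auto

text \<open>The next three lemmas follow the factors of a flag root product at \<open>(PInf, LInf)\<close> on the
  vertical line through the origin. An elation with center \<open>Slope c\<close> that preserves this line
  fixes its intersections with the fixed lines of slope \<open>c\<close>.\<close>

lemma slope_elation_on_axis:
  assumes g: "g \<in> plane_root_group A (Slope c) LInf" and w: "fst g (Aff 0 b0) = Aff 0 w"
  shows "fst g (Aff 0 b) = Aff 0 b"
proof -
  have col: "collineation A g"
    using g by (simp add: plane_root_group_def)
  have fixed: "fst g PInf = PInf" "snd g (Graph c b) = Graph c b"
    using g by (simp_all add: plane_root_group_def)
  have "incident A PInf (snd g (Vert 0))" "incident A (Aff 0 w) (snd g (Vert 0))"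
    using collineationD(3)[OF col, of PInf "Vert 0"] collineationD(3)[OF col, of "Aff 0 b0" "Vert 0"]
    by (simp_all add: fixed w)
  then have Vert: "snd g (Vert 0) = Vert 0"
    by (auto simp: incident_PInf_iff)
  have "incident A (fst g (Aff 0 b)) (Vert 0)" "incident A (fst g (Aff 0 b)) (Graph c b)"
    using collineationD(3)[OF col, of "Aff 0 b" "Vert 0"] collineationD(3)[OF col, of "Aff 0 b" "Graph c b"]
    by (simp_all add: fixed Vert)
  then show ?thesis
    by (auto simp: incident_Vert_iff)
qed

text \<open>Here every line is moved to a parallel one. The displacement of the horizontal line through
  the origin is carried to the vertical axis along lines of slope \<open>\<e>\<close>.\<close>

lemma central_elation_on_axis:
  assumes g: "g \<in> plane_root_group A PInf LInf"
  obtains v where "\<And>b. fst g (Aff 0 b) = Aff 0 (b + v)"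
proof -
  have col: "collineation A g"
    using g by (simp add: plane_root_group_def)
  have fixed: "fst g PInf = PInf" "\<And>c. fst g (Slope c) = Slope c" "snd g LInf = LInf"
      "\<And>a. snd g (Vert a) = Vert a"
    using g by (simp_all add: plane_root_group_def)
  have Graph: "\<exists>k'. snd g (Graph m k) = Graph m k'" for m k
    using collineationD(3)[OF col, of "Slope m" "Graph m k"]
      collineationD(5)[OF col, of "Graph m k" LInf]
    by (auto simp: fixed incident_Slope_iff)
  have Aff: "\<exists>b'. fst g (Aff a b) = Aff a b'" for a b
    using collineationD(3)[OF col, of "Aff a b" "Vert a"] collineationD(4)[OF col, of "Aff a b" PInf]
    by (auto simp: fixed incident_Vert_iff)
  obtain v where v: "snd g (Graph 0 0) = Graph 0 v"
    using Graph by blast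
  have "fst g (Aff 0 b) = Aff 0 (b + v)" for b
  proof -
    obtain k where k: "snd g (Graph \<e> b) = Graph \<e> k"
      using Graph by blast
    obtain y where y: "fst g (Aff b 0) = Aff b y"
      using Aff by blast
    obtain x where x: "fst g (Aff 0 b) = Aff 0 x"
      using Aff by blast
    have "y = v"
      using collineationD(3)[OF col, of "Aff b 0" "Graph 0 0"] v y by simp
    moreover have "b + y = k"
      using collineationD(3)[OF col, of "Aff b 0" "Graph \<e> b"] k y by simp
    moreover have "x = k"
      using collineationD(3)[OF col, of "Aff 0 b" "Graph \<e> b"] k x by simp
    ultimately show ?thesis
      using x by simp
  qed
  then show thesis
    by (rule that)
qed

text \<open>All horizontal lines receive a common slope \<open>m\<close>, while their points on \<open>Vert l\<close> stay fixed;
  so their intersections with \<open>Vert 0\<close> move by \<open>m l\<close>.\<close>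

lemma vertical_elation_on_axis:
  assumes g: "g \<in> plane_root_group A PInf (Vert l)"
  obtains v where "\<And>b. fst g (Aff 0 b) = Aff 0 (b + v)"
proof -
  have col: "collineation A g"
    using g by (simp add: plane_root_group_def)
  have fixed: "fst g PInf = PInf" "\<And>b. fst g (Aff l b) = Aff l b" "snd g LInf = LInf"
      "\<And>a. snd g (Vert a) = Vert a"
    using g by (simp_all add: plane_root_group_def)
  obtain m where m: "fst g (Slope 0) = Slope m"
    using collineationD(3)[OF col, of "Slope 0" LInf] collineationD(4)[OF col, of "Slope 0" PInf]
    by (auto simp: fixed incident_LInf_iff)
  have "fst g (Aff 0 b) = Aff 0 (b + m \<cdot> l)" for b
  proof -
    obtain k where k: "snd g (Graph 0 b) = Graph m k"
      using collineationD(3)[OF col, of "Slope 0" "Graph 0 b"]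
        collineationD(5)[OF col, of "Graph 0 b" LInf]
      by (auto simp: fixed m incident_Slope_iff)
    obtain x where x: "fst g (Aff 0 b) = Aff 0 x"
      using collineationD(3)[OF col, of "Aff 0 b" "Vert 0"] collineationD(4)[OF col, of "Aff 0 b" PInf]
      by (auto simp: fixed incident_Vert_iff)
    have "m \<cdot> l + b = k"
      using collineationD(3)[OF col, of "Aff l b" "Graph 0 b"] k by (simp add: fixed)
    moreover have "x = k"
      using collineationD(3)[OF col, of "Aff 0 b" "Graph 0 b"] k x by simp
    ultimately show ?thesis
      using x by (simp add: add.commute)
  qed
  then show thesis
    by (rule that)
qed

text \<open>If the product maps one point of \<open>Vert 0\<close> into \<open>Vert 0\<close>, so does its first factor, since
  the other two preserve that line.\<close>

lemma flag_root_product_at_infinity: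
  assumes apt: "apartment_through A PInf LInf (q, m)"
    and g: "g \<in> flag_root_product A PInf LInf (q, m)"
    and w: "fst g (Aff 0 0) = Aff 0 w"
  shows "fst g (Aff 0 b) = Aff 0 (b + w)"
proof -
  obtain c where q: "q = Slope c"
    using apt by (auto simp: apartment_through_def incident_LInf_iff)
  obtain l where m: "m = Vert l"
    using apt by (auto simp: apartment_through_def incident_PInf_iff)
  obtain g1 g2 g3 where gs: "g1 \<in> plane_root_group A (Slope c) LInf"
      "g2 \<in> plane_root_group A PInf LInf" "g3 \<in> plane_root_group A PInf (Vert l)"
      and eq: "fst g = fst g1 \<circ> fst g2 \<circ> fst g3"
    using g by (auto simp: flag_root_product_def q m)
  obtain v2 where v2: "\<And>b. fst g2 (Aff 0 b) = Aff 0 (b + v2)"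
    using central_elation_on_axis[OF gs(2)] by blast
  obtain v3 where v3: "\<And>b. fst g3 (Aff 0 b) = Aff 0 (b + v3)"
    using vertical_elation_on_axis[OF gs(3)] by blast
  have "fst g1 (Aff 0 (v3 + v2)) = Aff 0 w"
    using w by (simp add: eq v2 v3)
  then have g1: "fst g1 (Aff 0 b) = Aff 0 b" for b
    by (rule slope_elation_on_axis[OF gs(1)])
  have "w = v3 + v2"
    using w by (simp add: eq v2 v3 g1)
  then show ?thesis
    by (simp add: eq v2 v3 g1 add.assoc)
qed

text \<open>In characteristic 2 this says that inversion maps the points \<open>(a, b)\<close> of the line \<open>[m, k]\<close>
  to points of \<open>[k\<^sup>-\<^sup>1 m, k\<^sup>-\<^sup>1]\<close>. In an associative algebra it would follow from
  \<open>m a = k - b\<close> alone; the middle Moufang identity replaces associativity after substituting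
  \<open>k = b + m a\<close>.\<close>

lemma inversion_identity:
  assumes "m \<cdot> a + b = k" "b \<noteq> 0" "k \<noteq> 0"
  shows "(oinv k \<cdot> m) \<cdot> (a \<cdot> oinv b) = oinv b - oinv k"
proof -
  have k: "k = b + m \<cdot> a"
    using assms by (simp add: add.commute)
  have "cj k \<cdot> m = cj b \<cdot> m + N m \<odot> cj a"
    by (simp add: k cj_hom cj_mul mul_hom cj_mul_cancel_right)
  then have "(cj k \<cdot> m) \<cdot> (a \<cdot> cj b) = (cj b \<cdot> m) \<cdot> (a \<cdot> cj b) + (N m * N a) \<odot> cj b"
    by (simp add: mul_hom cj_mul_cancel_left)
  also have "(cj b \<cdot> m) \<cdot> (a \<cdot> cj b) = B b (m \<cdot> a) \<odot> cj b - N b \<odot> cj (m \<cdot> a)"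
    by (simp add: middle_moufang polar_cj)
  also have "B b (m \<cdot> a) \<odot> cj b - N b \<odot> cj (m \<cdot> a) + (N m * N a) \<odot> cj b
      = N k \<odot> cj b - N b \<odot> cj k"
    by (simp add: k nrm_add nrm_mul cj_hom scale_left_distrib scale_right_distrib)
  finally have "(oinv k \<cdot> m) \<cdot> (a \<cdot> oinv b)
      = (inverse (N k) * inverse (N b)) \<odot> (N k \<odot> cj b - N b \<odot> cj k)"
    by (simp add: oct_inv_def mul_hom mult.commute)
  also have "\<dots> = (inverse (N k) * inverse (N b) * N k) \<odot> cj b
      - (inverse (N k) * inverse (N b) * N b) \<odot> cj k"
    by (simp add: scale_right_diff_distrib)
  also have "inverse (N k) * inverse (N b) * N k = inverse (N b)"
    using assms by (simp add: field_simps)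
  also have "inverse (N k) * inverse (N b) * N b = inverse (N k)"
    using assms by (simp add: field_simps)
  finally show ?thesis
    by (simp add: oct_inv_def)
qed

end

section \<open>Symmetries of the polarity\<close>

context type_IV_octonion
begin

abbreviation "Abs \<equiv> absolute_points A \<eta>"

lemma absolute_points_eq: "Abs = insert PInf (Aff 0 ` Fix)"
proof -
  have "Aff a b \<in> Abs \<longleftrightarrow> a = 0 \<and> b \<in> Fix" for a b
  proof -
    have "Aff a b \<in> Abs \<longleftrightarrow> \<sigma> a \<cdot> a + b + \<sigma> b = 0"
      using eq_iff_diff_eq_0[of "\<sigma> a \<cdot> a + b" "\<sigma> b"]
      by (simp add: absolute_points_def flip: \<sigma>_def)
    also have "\<dots> \<longleftrightarrow> a = 0 \<and> b + \<sigma> b = 0"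
      using hermitian_anisotropic[of a b] by auto
    also have "b + \<sigma> b = 0 \<longleftrightarrow> b \<in> Fix"
      using eq_iff_diff_eq_0[of "\<sigma> b" b] by (simp add: Fix_def add.commute)
    finally show ?thesis .
  qed
  moreover have "Slope c \<notin> Abs" "PInf \<in> Abs" for c
    by (simp_all add: absolute_points_def)
  ultimately have "p \<in> Abs \<longleftrightarrow> p \<in> insert PInf (Aff 0 ` Fix)" for p
    by (cases p) auto
  then show ?thesis
    by blast
qed

lemma polarity_point_simps:
  "polarity_point A \<eta> (Aff a b) = Graph (\<sigma> a) (\<sigma> b)"
  "polarity_point A \<eta> (Slope c) = Vert (\<sigma> c)"
  by (simp_all add: \<sigma>_def)

lemma polarity_inverse:
  "polarity_line A \<eta> (polarity_point A \<eta> p) = p" "polarity_point A \<eta> (polarity_line A \<eta> l) = l"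
  by (cases p; simp flip: \<sigma>_def) (cases l; simp flip: \<sigma>_def)

lemma commutes_iff:
  "commutes_with_polarity A \<eta> g \<longleftrightarrow>
    (\<forall>p. polarity_point A \<eta> (fst g p) = snd g (polarity_point A \<eta> p))"
  unfolding commutes_with_polarity_def by (metis polarity_inverse)

definition symmetry :: "'b plane_map \<Rightarrow> bool" where
  "symmetry g \<longleftrightarrow> collineation A g \<and> commutes_with_polarity A \<eta> g"

lemma symmetry_comp:
  "symmetry g \<Longrightarrow> symmetry h \<Longrightarrow> symmetry (fst g \<circ> fst h, snd g \<circ> snd h)"
  by (simp add: symmetry_def commutes_iff collineation_comp)

lemma symmetry_inv:
  assumes h: "symmetry h"
  shows "symmetry (plane_inv h)"
proof -
  have col: "collineation A h"
    using h by (simp add: symmetry_def)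
  have "polarity_point A \<eta> (inv_map (fst h) p) = inv_map (snd h) (polarity_point A \<eta> p)" for p
    using h unfolding symmetry_def commutes_iff by (metis collineation_inv_apply[OF col])
  then show ?thesis
    using collineation_inv[OF col] by (simp add: symmetry_def commutes_iff plane_inv_def)
qed

lemma symmetry_conj:
  assumes "symmetry h" "symmetry g"
  shows "symmetry (plane_conj h g)"
  using symmetry_comp[OF symmetry_comp[OF assms] symmetry_inv[OF assms(1)]]
  by (simp add: plane_conj_def plane_inv_def)

lemma symmetry_Abs: "symmetry g \<Longrightarrow> fst g p \<in> Abs \<longleftrightarrow> p \<in> Abs"
  by (simp add: symmetry_def commutes_iff absolute_points_def collineationD)

lemma symmetry_Bij:
  assumes g: "symmetry g"
  shows "restrict (fst g) Abs \<in> Bij Abs"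
proof -
  have col: "collineation A g"
    using g by (simp add: symmetry_def)
  have "bij_betw (fst g) Abs Abs"
    using symmetry_Abs[OF g] symmetry_Abs[OF symmetry_inv[OF g]]
    by (intro bij_betw_byWitness[where f' = "inv_map (fst g)"])
      (auto simp: collineation_inv_apply[OF col] plane_inv_def)
  then show ?thesis
    by (simp add: Bij_def)
qed

fun translate_point where
  "translate_point v (Aff a b) = Aff a (b + v)"
| "translate_point v (Slope c) = Slope c"
| "translate_point v PInf = PInf"

fun translate_line where
  "translate_line v (Graph m k) = Graph m (k + v)"
| "translate_line v (Vert l) = Vert l"
| "translate_line v LInf = LInf"

definition vertical_translation :: "'b \<Rightarrow> 'b plane_map" where
  "vertical_translation v = (translate_point v, translate_line v)"

lemma vertical_translation_root_group:
  "vertical_translation v \<in> plane_root_group A PInf LInf"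
proof -
  have "translate_point v (translate_point v p) = p" for p :: "'b point"
    by (cases p) (simp_all add: add.assoc)
  moreover have "translate_line v (translate_line v l) = l" for l :: "'b line"
    by (cases l) (simp_all add: add.assoc)
  ultimately have "bij (translate_point v)" "bij (translate_line v)"
    by (auto intro!: involuntory_imp_bij)
  moreover have "incident A (translate_point v p) (translate_line v l) = incident A p l" for p l
    by (cases p; cases l) (simp_all flip: add.assoc)
  ultimately show ?thesis
    by (auto simp: plane_root_group_def collineation_def vertical_translation_def
        incident_LInf_iff incident_PInf_iff)
qed

lemma vertical_translation_symmetry:
  assumes "v \<in> Fix"
  shows "symmetry (vertical_translation v)"
proof -
  have "polarity_point A \<eta> (translate_point v p) = translate_line v (polarity_point A \<eta> p)" for p
    using assms by (cases p) (simp_all add: polarity_point_simps sigma_add Fix_def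
        del: polarity_point.simps(1,2))
  then show ?thesis
    using vertical_translation_root_group[of v]
    by (simp add: symmetry_def commutes_iff plane_root_group_def) (simp add: vertical_translation_def)
qed

text \<open>Inversion, extended to the whole plane: it interchanges the absolute points \<open>PInf\<close> and
  \<open>Aff 0 0\<close>, and fixes the line joining them and the common point of their polars.\<close>

fun swap_point :: "'b point \<Rightarrow> 'b point" where
  "swap_point (Aff a b) = (if b \<noteq> 0 then Aff (a \<cdot> oinv b) (oinv b)
     else if a \<noteq> 0 then Slope (oinv a) else PInf)"
| "swap_point (Slope c) = (if c \<noteq> 0 then Aff (oinv c) 0 else Slope 0)"
| "swap_point PInf = Aff 0 0"

fun swap_line :: "'b line \<Rightarrow> 'b line" where
  "swap_line (Graph m k) = (if k \<noteq> 0 then Graph (oinv k \<cdot> m) (oinv k)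
     else if m \<noteq> 0 then Vert (oinv m) else LInf)"
| "swap_line (Vert l) = (if l \<noteq> 0 then Graph (oinv l) 0 else Vert 0)"
| "swap_line LInf = Graph 0 0"

lemma swap_involution: "swap_point (swap_point p) = p" "swap_line (swap_line l) = l"
  by (cases p; simp add: oinv_cancel) (cases l; simp add: oinv_cancel)

lemma oinv_mul: "x \<noteq> 0 \<Longrightarrow> y \<noteq> 0 \<Longrightarrow> oinv (x \<cdot> y) = oinv y \<cdot> oinv x"
  by (simp add: oct_inv_def cj_mul nrm_mul mul_hom mult.commute)

lemma swap_incident:
  assumes "incident A p l"
  shows "incident A (swap_point p) (swap_line l)"
proof (cases p)
  case (Aff a b)
  show ?thesis
  proof (cases l)
    case (Graph m k)
    have eq: "m \<cdot> a + b = k"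
      using assms Aff Graph by simp
    consider "b \<noteq> 0" "k \<noteq> 0" | "b \<noteq> 0" "k = 0" | "b = 0"
      by blast
    then show ?thesis
    proof cases
      case 1
      then show ?thesis
        using Aff Graph inversion_identity[OF eq] by (simp add: ac_simps)
    next
      case 2
      then have "b = m \<cdot> a"
        using eq vector_char_two(2)[of "m \<cdot> a" b] by simp
      then show ?thesis
        using 2 Aff Graph by (simp add: oinv_mul oinv_cancel)
    next
      case 3
      then show ?thesis
        using eq Aff Graph by (auto simp: oinv_mul oinv_cancel)
    qed
  next
    case (Vert c)
    then show ?thesis
      using assms Aff by (simp add: oinv_cancel)
  next
    case LInf
    then show ?thesis
      using assms Aff by simp
  qed
next
  case (Slope c)
  then show ?thesis
    using assms by (cases l) (auto simp: oinv_cancel)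
next
  case PInf
  then show ?thesis
    using assms by (cases l) auto
qed

lemma swap_symmetry: "symmetry (swap_point, swap_line)"
proof -
  have "incident A (swap_point p) (swap_line l) \<longleftrightarrow> incident A p l" for p l
    using swap_incident[of p l] swap_incident[of "swap_point p" "swap_line l"]
    by (auto simp: swap_involution)
  moreover have "bij swap_point" "bij swap_line"
    using swap_involution by (auto intro!: involuntory_imp_bij)
  moreover have "polarity_point A \<eta> (swap_point p) = swap_line (polarity_point A \<eta> p)" for p
    by (cases p) (simp_all add: polarity_point_simps sigma_mul sigma_oinv
        del: polarity_point.simps(1,2))
  ultimately show ?thesis
    by (simp add: symmetry_def commutes_iff collineation_def)
qed

definition move :: "'b point \<Rightarrow> 'b plane_map" where
  "move x = (case x of Aff a b \<Rightarrow>
       (translate_point b \<circ> swap_point, translate_line b \<circ> swap_line) | _ \<Rightarrow> (id, id))"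

lemma move_symmetry: "x \<in> Abs \<Longrightarrow> symmetry (move x)"
  using symmetry_comp[OF vertical_translation_symmetry swap_symmetry]
  by (auto simp: absolute_points_eq move_def vertical_translation_def)
    (simp add: symmetry_def commutes_iff collineation_def)

lemma move_PInf: "x \<in> Abs \<Longrightarrow> fst (move x) PInf = x"
  by (auto simp: absolute_points_eq move_def)

definition root_element :: "'b point \<Rightarrow> 'b \<Rightarrow> 'b point \<Rightarrow> 'b point" where
  "root_element x v = restrict (fst (plane_conj (move x) (vertical_translation v))) Abs"

lemma root_element_Bij: "x \<in> Abs \<Longrightarrow> v \<in> Fix \<Longrightarrow> root_element x v \<in> Bij Abs"
  unfolding root_element_def
  by (intro symmetry_Bij symmetry_conj move_symmetry vertical_translation_symmetry)

lemma root_element_apply: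
  assumes "x \<in> Abs" "p \<in> Abs"
  shows "root_element x v (fst (move x) p) = fst (move x) (translate_point v p)"
proof -
  have "collineation A (move x)"
    using move_symmetry[OF assms(1)] by (simp add: symmetry_def)
  then show ?thesis
    using symmetry_Abs[OF move_symmetry[OF assms(1)]] assms(2)
    by (simp add: root_element_def plane_conj_def vertical_translation_def collineation_inv_apply)
qed

lemma move_surj:
  assumes "x \<in> Abs" "p \<in> Abs"
  obtains p' where "p' \<in> Abs" "p = fst (move x) p'"
proof -
  have "collineation A (move x)"
    using move_symmetry[OF assms(1)] by (simp add: symmetry_def)
  then have "p = fst (move x) (inv_map (fst (move x)) p)"
    by (simp add: collineation_inv_apply)
  then show thesis
    using that assms(2) symmetry_Abs[OF move_symmetry[OF assms(1)]] by metis
qed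

text \<open>Conjugating by \<open>move x\<close> reduces to the flag \<open>(PInf, LInf)\<close> with an arbitrary apartment,
  where an element of the product that preserves the absolute points must be a translation
  of the vertical line carrying them.\<close>

lemma rootgrp_polarity_moufang_set:
  assumes x: "x \<in> Abs" and apt: "apartment_through A x (polarity_point A \<eta> x) (apt x)"
  shows "rootgrp (polarity_moufang_set A \<eta> apt) x = root_element x ` Fix"
proof -
  let ?h = "move x"
  let ?F = "flag_root_product A x (polarity_point A \<eta> x) (apt x)"
  have h: "symmetry ?h" and col: "collineation A ?h"
    using move_symmetry[OF x] by (simp_all add: symmetry_def)
  have line: "snd ?h LInf = polarity_point A \<eta> x"
    using h move_PInf[OF x] unfolding symmetry_def commutes_iff
    by (metis polarity_point.simps(3))
  have "root_element x v \<in> {restrict (fst g) Abs |g. g \<in> ?F \<and> commutes_with_polarity A \<eta> g}"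
    if v: "v \<in> Fix" for v
  proof -
    let ?g = "plane_conj ?h (vertical_translation v)"
    have "?g \<in> plane_root_group A x (polarity_point A \<eta> x)"
      using plane_root_group_conj[OF col vertical_translation_root_group] move_PInf[OF x] line
      by metis
    then have "?g \<in> ?F"
      by (rule plane_root_group_subset_product)
    moreover have "commutes_with_polarity A \<eta> ?g"
      using symmetry_conj[OF h vertical_translation_symmetry[OF v]] by (simp add: symmetry_def)
    ultimately show ?thesis
      unfolding root_element_def by blast
  qed
  moreover have "restrict (fst g) Abs \<in> root_element x ` Fix"
    if g: "g \<in> ?F" "commutes_with_polarity A \<eta> g" for g
  proof -
    let ?k = "plane_inv ?h"
    have k: "symmetry ?k" "collineation A ?k"
      using symmetry_inv[OF h] by (simp_all add: symmetry_def)
    have k_PInf: "fst ?k x = PInf" "snd ?k (polarity_point A \<eta> x) = LInf"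
      using collineation_inv_apply(1)[OF col, of PInf] collineation_inv_apply(3)[OF col, of LInf]
        move_PInf[OF x] line by (simp_all add: plane_inv_def)
    obtain q m where qm: "apt x = (q, m)"
      by fastforce
    let ?q = "fst ?k q" and ?m = "snd ?k m"
    have apt': "apartment_through A PInf LInf (?q, ?m)"
      using apt collineationD(3-5)[OF k(2)] k_PInf
      unfolding apartment_through_def qm fst_conv snd_conv by metis
    let ?g = "plane_conj ?k g"
    have g': "?g \<in> flag_root_product A PInf LInf (?q, ?m)"
      using flag_root_product_conj[OF k(2), of g] g k_PInf qm by metis
    have sym: "symmetry ?g"
      using g collineation_flag_root_product[OF g(1)] symmetry_conj[OF k(1), of g]
      by (simp add: symmetry_def)
    have PInf: "fst ?g PInf = PInf"
      using flag_root_product_fixes[OF g'] apt' by (simp add: apartment_through_def)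
    have "fst ?g (Aff 0 0) \<in> Abs"
      using symmetry_Abs[OF sym] subspace_0[OF subspace_Fix] by (simp add: absolute_points_eq)
    moreover have "fst ?g (Aff 0 0) \<noteq> PInf"
      using sym PInf collineationD(4)[of ?g "Aff 0 0" PInf] by (simp add: symmetry_def)
    ultimately obtain w where w: "w \<in> Fix" "fst ?g (Aff 0 0) = Aff 0 w"
      by (auto simp: absolute_points_eq)
    have translate: "fst ?g p = translate_point w p" if "p \<in> Abs" for p
      using that PInf flag_root_product_at_infinity[OF apt' g' w(2)]
      by (auto simp: absolute_points_eq)
    have "fst g p = root_element x w p" if p: "p \<in> Abs" for p
    proof -
      obtain p' where p': "p' \<in> Abs" "p = fst ?h p'"
        using move_surj[OF x p] by blast
      have "fst ?h (fst ?g p') = fst g (fst ?h p')"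
        using collineationD(1)[OF col]
        by (simp add: plane_conj_def plane_inv_def collineation_inv_apply[OF col] inv_inv_eq)
      then show ?thesis
        using translate[OF p'(1)] root_element_apply[OF x p'(1)] p'(2) by simp
    qed
    then have "restrict (fst g) Abs = root_element x w"
      by (auto simp: fun_eq_iff root_element_def)
    then show ?thesis
      using w by blast
  qed
  ultimately show ?thesis
    by (auto simp: polarity_moufang_set_def)
qed

lemma rootgrp_iso:
  assumes x: "x \<in> Abs"
  shows "(BijGroup Abs)\<lparr>carrier := root_element x ` Fix\<rparr> \<cong> additive_group Fix"
proof -
  interpret add: group "additive_group Fix"
    using subspace_Fix by (rule additive_group_subspace)
  have Aff: "Aff 0 v \<in> Abs" if "v \<in> Fix" for v
    using that by (simp add: absolute_points_eq)
  have "root_element x (v + w) = root_element x v \<otimes>\<^bsub>BijGroup Abs\<^esub> root_element x w"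
    if vw: "v \<in> Fix" "w \<in> Fix" for v w
  proof (rule Bij_eqI[of _ Abs])
    show "root_element x (v + w) \<in> Bij Abs"
      "root_element x v \<otimes>\<^bsub>BijGroup Abs\<^esub> root_element x w \<in> Bij Abs"
      using x vw subspace_add[OF subspace_Fix] root_element_Bij
        group.is_monoid[OF group_BijGroup, of Abs, THEN monoid.m_closed]
      by simp_all
    fix p assume "p \<in> Abs"
    then obtain p' where p': "p' \<in> Abs" "p = fst (move x) p'"
      using move_surj[OF x] by blast
    have "translate_point w p' \<in> Abs"
      using p' vw subspace_add[OF subspace_Fix] by (auto simp: absolute_points_eq)
    moreover have "translate_point (v + w) p' = translate_point v (translate_point w p')"
      by (cases p') (simp_all add: ac_simps)
    ultimately show "root_element x (v + w) p
        = (root_element x v \<otimes>\<^bsub>BijGroup Abs\<^esub> root_element x w) p"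
      using \<open>p \<in> Abs\<close> x vw p' by (simp add: BijGroup_mult_apply root_element_Bij root_element_apply)
  qed
  moreover have "inj_on (root_element x) Fix"
  proof (rule inj_onI)
    fix v w assume "v \<in> Fix" "w \<in> Fix" and eq: "root_element x v = root_element x w"
    have "fst (move x) (Aff 0 v) = fst (move x) (Aff 0 w)"
      using root_element_apply[OF x Aff[of 0], of v] root_element_apply[OF x Aff[of 0], of w] eq
        subspace_0[OF subspace_Fix] by simp
    then show "v = w"
      using move_symmetry[OF x] by (simp add: symmetry_def collineationD)
  qed
  ultimately have "root_element x \<in> iso (additive_group Fix)
      ((BijGroup Abs)\<lparr>carrier := root_element x ` Fix\<rparr>)"
    by (intro isoI) (auto simp: hom_def bij_betw_def)
  then show ?thesis
    using add.iso_sym is_isoI by blast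
qed

section \<open>The isomorphism\<close>

definition coordinate :: "'b point \<Rightarrow> 'b option" where
  "coordinate p = (case p of Aff a b \<Rightarrow> Some b | _ \<Rightarrow> None)"

lemma moufang_isomorphic_polarity:
  assumes apt: "\<forall>x\<in>Abs. apartment_through A x (polarity_point A \<eta> x) (apt x)"
  shows "moufang_isomorphic (polarity_moufang_set A \<eta> apt) (mu_set (additive_group Fix) oinv)"
proof -
  let ?G = "additive_group Fix" and ?M = "polarity_moufang_set A \<eta> apt"
  interpret group ?G
    using subspace_Fix by (rule additive_group_subspace)
  interpret involutive_mu ?G oinv
    by unfold_locales (use subspace_Fix one_Fix oinv_in_subspace in auto)
  have points: "points ?M = Abs"
    by (simp add: polarity_moufang_set_def)
  have bij: "bij_betw coordinate Abs X"
    by (rule bij_betw_byWitness[where f' = "\<lambda>y. case y of None \<Rightarrow> PInf | Some b \<Rightarrow> Aff 0 b"])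
      (auto simp: absolute_points_eq coordinate_def mu_points_def)
  have coordinate_X: "coordinate p \<in> X" if "p \<in> Abs" for p
    using bij that by (rule bij_betwE[THEN bspec])
  have coordinate_translate: "coordinate (translate_point v p) = \<alpha> v (coordinate p)" if "p \<in> Abs" for v p
    using that by (auto simp: absolute_points_eq coordinate_def mu_alpha_def)
  have translate_Abs: "translate_point v p \<in> Abs" if "v \<in> Fix" "p \<in> Abs" for v p
    using that subspace_add[OF subspace_Fix] by (auto simp: absolute_points_eq)
  have coordinate_swap: "coordinate (swap_point p) = t (coordinate p)" if "p \<in> Abs" for p
    using that by (auto simp: absolute_points_eq coordinate_def mu_tau_def)
  have swap_Abs: "swap_point p \<in> Abs" if "p \<in> Abs" for p
    using symmetry_Abs[OF swap_symmetry] that by simp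
  have coordinate_move: "coordinate (fst (move x) p) = carry (coordinate x) (coordinate p)"
    if xp: "x \<in> Abs" "p \<in> Abs" for x p
  proof -
    consider "x = PInf" | b where "x = Aff 0 b" "b \<in> Fix"
      using xp by (auto simp: absolute_points_eq)
    then show ?thesis
    proof cases
      case 1
      then show ?thesis
        using xp coordinate_X
        by (simp add: move_def carry_def BijGroup_one_apply) (simp add: coordinate_def carry_def BijGroup_one_apply)
    next
      case 2
      then have "coordinate x = Some b"
        by (simp add: coordinate_def)
      then show ?thesis
        using 2 xp by (simp add: move_def carry_def BijGroup_mult_apply coordinate_X
            coordinate_translate coordinate_swap swap_Abs)
    qed
  qed
  have "(\<lambda>u. \<lambda>y\<in>X. coordinate (u (inv_into Abs coordinate y))) ` rootgrp ?M x
      = rootgrp (mu_set ?G oinv) (coordinate x)" if x: "x \<in> Abs" for x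
  proof -
    let ?c = "carry (coordinate x)"
    have c: "?c \<in> Bij X"
      using carry_Bij coordinate_X x by simp
    have "(\<lambda>y\<in>X. coordinate (root_element x v (inv_into Abs coordinate y)))
        = ?c \<otimes>\<^bsub>BijGroup X\<^esub> \<alpha> v \<otimes>\<^bsub>BijGroup X\<^esub> inv\<^bsub>BijGroup X\<^esub> ?c" if v: "v \<in> Fix" for v
    proof (rule extensionalityI[of _ X])
      have i: "inv\<^bsub>BijGroup X\<^esub> ?c \<in> Bij X"
        using Bij.inv_closed c by simp
      then have "?c \<otimes>\<^bsub>BijGroup X\<^esub> \<alpha> v \<otimes>\<^bsub>BijGroup X\<^esub> inv\<^bsub>BijGroup X\<^esub> ?c \<in> Bij X"
        using c v by simp
      then show "?c \<otimes>\<^bsub>BijGroup X\<^esub> \<alpha> v \<otimes>\<^bsub>BijGroup X\<^esub> inv\<^bsub>BijGroup X\<^esub> ?c \<in> extensional X"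
        by (rule Bij_imp_extensional)
      fix y assume y: "y \<in> X"
      then obtain p where p: "p \<in> Abs" "y = coordinate p"
        using bij by (auto simp: bij_betw_def)
      obtain p' where p': "p' \<in> Abs" "p = fst (move x) p'"
        using move_surj[OF x p(1)] by blast
      have yc: "y = ?c (coordinate p')"
        using p p' x coordinate_move by simp
      have "coordinate (root_element x v (inv_into Abs coordinate y))
          = coordinate (root_element x v p)"
        using p bij by (simp add: bij_betw_inv_into_left)
      also have "\<dots> = ?c (\<alpha> v (coordinate p'))"
        using p' x v by (simp add: root_element_apply coordinate_move translate_Abs coordinate_translate)
      also have "\<dots> = (?c \<otimes>\<^bsub>BijGroup X\<^esub> \<alpha> v \<otimes>\<^bsub>BijGroup X\<^esub> inv\<^bsub>BijGroup X\<^esub> ?c) y"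
        using y c v i p' coordinate_X
        by (simp add: BijGroup_mult_apply Bij_apply) (simp add: yc BijGroup_inv_apply)
      finally show "(\<lambda>y\<in>X. coordinate (root_element x v (inv_into Abs coordinate y))) y
          = (?c \<otimes>\<^bsub>BijGroup X\<^esub> \<alpha> v \<otimes>\<^bsub>BijGroup X\<^esub> inv\<^bsub>BijGroup X\<^esub> ?c) y"
        using y by simp
    qed simp
    then show ?thesis
      using apt x coordinate_X
      by (simp add: rootgrp_polarity_moufang_set rootgrp_mu_set conj_set_def image_image)
  qed
  moreover have "rootgrp ?M x \<subseteq> Bij Abs" if "x \<in> Abs" for x
    using that apt root_element_Bij by (auto simp: rootgrp_polarity_moufang_set)
  ultimately show ?thesis
    using moufang_set_subspace[OF subspace_Fix one_Fix] bij
    by (intro moufang_set_transport[where \<beta> = coordinate]) (simp_all add: points)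
qed

lemma projective_moufang_subset_Fix:
  "projective_moufang_subset A (mu_set (additive_group Fix) oinv)"
proof -
  have tau: "projective_tau A = oinv"
    by (simp add: fun_eq_iff projective_tau_def)
  have "subgroup Fix (additive_group UNIV)"
    using subspace_Fix one_Fix additive_group_subspace[OF subspace_UNIV]
    by (intro group.subgroupI) (auto simp: subspace_0 subspace_add)
  moreover have "oinv ` (Fix - {0}) = Fix - {0}"
  proof
    show "oinv ` (Fix - {0}) \<subseteq> Fix - {0}"
      using oinv_in_subspace[OF subspace_Fix one_Fix] by auto
    have "x \<in> oinv ` (Fix - {0})" if "x \<in> Fix - {0}" for x
      using that oinv_in_subspace[OF subspace_Fix one_Fix] by (intro image_eqI[of _ _ "oinv x"]) auto
    then show "Fix - {0} \<subseteq> oinv ` (Fix - {0})"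
      by blast
  qed
  ultimately show ?thesis
    unfolding projective_moufang_subset_def tau by blast
qed

end

theorem mainTheorem5:
  fixes A :: "('k::field, 'a::ab_group_add) normed_alg"
    and D V :: "'a set" and z :: 'a and \<eta> :: "'a \<Rightarrow> 'a"
    and apt :: "'a point \<Rightarrow> 'a point \<times> 'a line"
  assumes "octonion_division_algebra A"
    and "CHAR('k) = 2"
    and "type_IV_automorphism A D z \<eta>"
    and "\<forall>x\<in>absolute_points A \<eta>. apartment_through A x (polarity_point A \<eta> x) (apt x)"
    and "V = {y. \<eta> (oct_conj A y) = y}"
  shows "projective_moufang_subset A (mu_set (additive_group V) (oct_inv A)) \<and>
    moufang_isomorphic (polarity_moufang_set A \<eta> apt) (mu_set (additive_group V) (oct_inv A)) \<and>
    module.subspace (scl A) V \<and> vector_space.dim (scl A) V = 5 \<and>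
    (\<forall>x\<in>absolute_points A \<eta>.
       (BijGroup (absolute_points A \<eta>))\<lparr>carrier := rootgrp (polarity_moufang_set A \<eta> apt) x\<rparr>
         \<cong> additive_group V)"
proof -
  interpret type_IV_octonion A D z \<eta>
    using assms by unfold_locales
  have V: "V = Fix"
    using assms by (simp add: Fix_def \<sigma>_def)
  show ?thesis
    unfolding V
    using projective_moufang_subset_Fix moufang_isomorphic_polarity[of apt] subspace_Fix dim_Fix
      rootgrp_iso rootgrp_polarity_moufang_set[of _ apt] assms(4)
    by simp
qed

end
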